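(* Let $\mathcal{M},\mathcal{N}\subset\mathbb{R}^n$ be two manifolds that are $\mathcal{C}^k$-smooth ($k\geq 2$) around a point $\bar{x}\in\mathcal{M}\cap\mathcal{N}$, such that $\mathcal{M}\cap\mathcal{N}$ is a $\mathcal{C}^k$-smooth manifold around $\bar{x}$ and $\mathrm{T}_{\mathcal{M}\cap\mathcal{N}}(\bar{x})=\mathrm{T}_{\mathcal{M}}(\bar{x})\cap\mathrm{T}_{\mathcal{N}}(\bar{x})$. Let $S=(1-\alpha)I+\alpha\,\Pi^{\alpha_2}_{\mathcal{M}}\Pi^{\alpha_1}_{\mathcal{N}}$ be the generalized alternating projections operator with parameters satisfying $\alpha\in(0,1]$, $\alpha_1,\alpha_2\in(0,2]$ and either (B1) $\alpha_1,\alpha_2\in(0,2)$, or (B2) $\alpha\in(0,1)$ with $\alpha_1\neq 2$ or $\alpha_2\neq 2$. Then 1. for all $c>\|S_{\mathrm{T}(\bar{x})}-\Pi_{\mathrm{T}_{\mathcal{M}}(\bar{x})\cap\mathrm{T}_{\mathcal{N}}(\bar{x})}\|$, where $S_{\mathrm{T}(\bar{x})}\coloneqq(1-\alpha)I+\alpha\,\Pi^{\alpha_2}_{\mathrm{T}_{\mathcal{M}}(\bar{x})}\Pi^{\alpha_1}_{\mathrm{T}_{\mathcal{N}}(\bar{x})}$, there exists some $\eta>0$ so that for all $x\in\mathcal{B}_\eta(\bar{x})$ \[ \|S(x)-\Pi_{\mathcal{M}\cap\mathcal{N}}(x)\|\leq c\,\|x-\Pi_{\mathcal{M}\cap\mathcal{N}}(x)\|;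 \] 2. for all $\mu_{\bar{x}}\in(\gamma(S_{\mathrm{T}(\bar{x})}),1)$ there exists $N\in\mathbb{N}$ such that for any $k\geq N$ \[ \limsup_{x\to\bar{x},\,x\notin\mathcal{M}\cap\mathcal{N}}\frac{\|S^k(x)-\Pi_{\mathcal{M}\cap\mathcal{N}}(x)\|}{\|x-\Pi_{\mathcal{M}\cap\mathcal{N}}(x)\|}\leq\mu_{\bar{x}}^k. \]
   Context: For a closed nonempty set $C$, $\Pi_C$ is the projection and $\Pi_C^{\alpha}\coloneqq(1-\alpha)I+\alpha\Pi_C$ the relaxed projection. $\mathcal{B}_\eta(\bar{x})$ is the closed ball of radius $\eta$ around $\bar{x}$. For a matrix $A$ with spectral radius at most 1, $\gamma(A)\coloneqq\max\{|\lambda|\mid\lambda\in\{0\}\cup\Lambda(A)\setminus\{1\}\}$, where $\Lambda(A)$ is the set of eigenvalues of $A$. Tangent spaces are $\mathrm{T}_{\mathcal{M}}(x)=\ker \mathrm{J}F(x)$ for a local defining function $F$. *)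

theory Defs
  imports "HOL-Analysis.Analysis" "HOL-Library.Liminf_Limsup"
begin

fun Ck_on :: "nat \<Rightarrow> 'a::euclidean_space set \<Rightarrow> ('a \<Rightarrow> real) \<Rightarrow> bool" where
  "Ck_on 0 U f = continuous_on U f"
| "Ck_on (Suc k) U f =
     (f differentiable_on U \<and> continuous_on U f \<and>
      (\<forall>i\<in>Basis. Ck_on k U (\<lambda>x. frechet_derivative f (at x) i)))"

text \<open>F = (F 0, ..., F (m-1)) : R^n -> R^m is a local C^k defining function of M around x
  on the open neighbourhood U: M \<inter> U = F^{-1}(0) \<inter> U and JF(x) is surjective.\<close>
definition local_defining_fun ::
  "nat \<Rightarrow> 'a::euclidean_space set \<Rightarrow> 'a \<Rightarrow> 'a set \<Rightarrow> (nat \<Rightarrow> 'a \<Rightarrow> real) \<Rightarrow> nat \<Rightarrow> bool" where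
  "local_defining_fun k M x U F m \<longleftrightarrow>
     open U \<and> x \<in> U \<and> (\<forall>i<m. Ck_on k U (F i)) \<and>
     (\<forall>c::nat \<Rightarrow> real. (\<forall>v. (\<Sum>i<m. c i * frechet_derivative (F i) (at x) v) = 0)
                       \<longrightarrow> (\<forall>i<m. c i = 0)) \<and>
     M \<inter> U = {y \<in> U. \<forall>i<m. F i y = 0}"

definition Ck_manifold_around :: "nat \<Rightarrow> 'a::euclidean_space set \<Rightarrow> 'a \<Rightarrow> bool" where
  "Ck_manifold_around k M x \<longleftrightarrow> x \<in> M \<and> (\<exists>U F m. local_defining_fun k M x U F m)"

definition tangent_space :: "'a::euclidean_space set \<Rightarrow> 'a \<Rightarrow> 'a set" where
  "tangent_space M x = (SOME T. \<exists>U F m. local_defining_fun 1 M x U F m \<and>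
      T = {v. \<forall>i<m. frechet_derivative (F i) (at x) v = 0})"

definition proj :: "'a::euclidean_space set \<Rightarrow> 'a \<Rightarrow> 'a" where
  "proj C x = (SOME y. y \<in> C \<and> (\<forall>z\<in>C. dist x y \<le> dist x z))"

definition rproj :: "real \<Rightarrow> 'a::euclidean_space set \<Rightarrow> 'a \<Rightarrow> 'a" where
  "rproj a C x = (1 - a) *\<^sub>R x + a *\<^sub>R proj C x"

definition GAP :: "real \<Rightarrow> real \<Rightarrow> real \<Rightarrow> 'a::euclidean_space set \<Rightarrow> 'a set \<Rightarrow> 'a \<Rightarrow> 'a" where
  "GAP \<alpha> \<alpha>1 \<alpha>2 M N x = (1 - \<alpha>) *\<^sub>R x + \<alpha> *\<^sub>R rproj \<alpha>2 M (rproj \<alpha>1 N x)"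

text \<open>(Complex) eigenvalues of a real linear map, i.e. eigenvalues of its complexification:
  A(u + iv) = \<lambda>(u + iv) with u + iv \<noteq> 0.\<close>
definition eigenvalues :: "('a::euclidean_space \<Rightarrow> 'a) \<Rightarrow> complex set" where
  "eigenvalues A = {l. \<exists>u v. (u \<noteq> 0 \<or> v \<noteq> 0) \<and>
      A u = Re l *\<^sub>R u - Im l *\<^sub>R v \<and> A v = Im l *\<^sub>R u + Re l *\<^sub>R v}"

definition gamma :: "('a::euclidean_space \<Rightarrow> 'a) \<Rightarrow> real" where
  "gamma A = Max (cmod ` ({0} \<union> (eigenvalues A - {1})))"

end

theory Submission
  imports Defs "HOL-Computational_Algebra.Fundamental_Theorem_Algebra"
begin

text \<open>Let \<open>p\<close> be the projection of \<open>x\<close> onto \<open>M \<inter> N\<close>; it is a fixed point of the operator \<open>S\<close>.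
  For a \<open>C\<^sup>1\<close> manifold \<open>M\<close> with tangent space \<open>T\<close> at the base point, any nearest-point map
  satisfies \<open>\<Pi>\<^sub>M y - p = \<Pi>\<^sub>T (y - p) + o(y - p)\<close> for \<open>p \<in> M\<close> and \<open>y\<close> near the base point, because
  \<open>\<Pi>\<^sub>M y - p\<close> is almost tangent and \<open>y - \<Pi>\<^sub>M y\<close> almost normal. Such expansions compose, so
  \<open>S\<^sup>j x - p = S\<^sub>T\<^sup>j (x - p) + o(x - p)\<close>, and for \<open>M \<inter> N\<close> itself the expansion says that the
  tangential part of \<open>x - p\<close> is \<open>o(x - p)\<close>. Hence the contraction factor of \<open>S\<^sup>j\<close> is asymptotically
  at most the norm of \<open>S\<^sub>T\<^sup>j - \<Pi> = (S\<^sub>T - \<Pi>)\<^sup>j\<close>, where \<open>\<Pi>\<close> projects onto the intersection of the tangent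
  spaces, the fixed space of \<open>S\<^sub>T\<close>. The spectral radius of \<open>S\<^sub>T - \<Pi>\<close> is at most \<open>\<gamma>(S\<^sub>T)\<close>.\<close>

section \<open>Powers of a real linear map and its complex eigenvalues\<close>

text \<open>The complexification of a real space is modelled on pairs, \<open>(u, v)\<close> standing for
  \<open>u + iv\<close>; a real linear map \<open>A\<close> acts on it as \<open>map_prod A A\<close>.\<close>

definition cscale :: "complex \<Rightarrow> 'a::real_vector \<times> 'a \<Rightarrow> 'a \<times> 'a" where
  "cscale c w = (Re c *\<^sub>R fst w - Im c *\<^sub>R snd w, Im c *\<^sub>R fst w + Re c *\<^sub>R snd w)"

lemma cscale_add_left: "cscale (a + b) w = cscale a w + cscale b w"
  and cscale_add_right: "cscale a (w + w') = cscale a w + cscale a w'"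
  and cscale_mult: "cscale (a * b) w = cscale a (cscale b w)"
  and cscale_1: "cscale 1 w = w"
  and cscale_0_left: "cscale 0 w = 0"
  and cscale_0_right: "cscale a 0 = 0"
  and cscale_minus_left: "cscale (- a) w = - cscale a w"
  and cscale_of_real: "cscale (of_real r) w = r *\<^sub>R w"
  by (auto simp: cscale_def prod_eq_iff algebra_simps)

lemma cscale_eq_0_iff: "cscale a w = 0 \<longleftrightarrow> a = 0 \<or> w = 0"
proof -
  have "w = 0" if "cscale a w = 0" "a \<noteq> 0"
  proof -
    have "w = cscale (inverse a) (cscale a w)"
      using that(2) by (simp add: cscale_1 flip: cscale_mult)
    then show ?thesis by (simp add: that(1) cscale_0_right)
  qed
  then show ?thesis by (auto simp: cscale_0_left cscale_0_right)
qed

lemma norm_cscale: "norm (cscale c (w :: 'a::real_inner \<times> 'a)) = cmod c * norm w"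
proof -
  have "norm (cscale c w)^2 = (cmod c * norm w)^2"
    unfolding power_mult_distrib cmod_power2 power2_norm_eq_inner
    by (simp add: cscale_def inner_prod_def algebra_simps power2_eq_square inner_commute)
  then show ?thesis by (simp add: power2_eq_iff_nonneg)
qed

lemma cscale_map_prod:
  assumes "linear A"
  shows "map_prod A A (cscale c w) = cscale c (map_prod A A w)"
  using assms by (auto simp: cscale_def prod_eq_iff linear_add linear_diff linear_scale)

lemma linear_map_prod:
  assumes "linear A"
  shows "linear (map_prod A A)"
  using assms by (intro linearI) (auto simp: prod_eq_iff linear_add linear_scale)

text \<open>Horner evaluation of p(A) on the complexification; complex coefficients let
  \<open>p\<close> split into linear factors.\<close>

definition poly_act :: "('a::real_vector \<Rightarrow> 'a) \<Rightarrow> complex poly \<Rightarrow> 'a \<times> 'a \<Rightarrow> 'a \<times> 'a" where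
  "poly_act A p = fold_coeffs (\<lambda>a f w. cscale a w + map_prod A A (f w)) p (\<lambda>w. 0)"

context
  fixes A :: "'a::real_vector \<Rightarrow> 'a"
  assumes lin: "linear A"
begin

lemma poly_act_0 [simp]: "poly_act A 0 w = 0"
  by (simp add: poly_act_def)

lemma poly_act_pCons [simp]:
  "poly_act A (pCons a p) w = cscale a w + map_prod A A (poly_act A p w)"
  using linear_0[OF linear_map_prod[OF lin]]
  by (cases "p = 0 \<and> a = 0") (auto simp: poly_act_def cscale_0_left)

lemma poly_act_add: "poly_act A (p + q) w = poly_act A p w + poly_act A q w"
  by (induction p q rule: poly_induct2)
     (auto simp: cscale_add_left linear_add[OF linear_map_prod[OF lin]])

lemma poly_act_sum: "poly_act A (sum f I) w = (\<Sum>i\<in>I. poly_act A (f i) w)"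
  by (induction I rule: infinite_finite_induct) (auto simp: poly_act_add)

lemma poly_act_smult: "poly_act A (smult c p) w = cscale c (poly_act A p w)"
  by (induction p) (auto simp: cscale_0_right cscale_mult cscale_add_right cscale_map_prod lin)

lemma poly_act_monom: "poly_act A (monom c n) w = cscale c ((map_prod A A ^^ n) w)"
proof (induction n)
  case 0
  show ?case using linear_0[OF linear_map_prod[OF lin]] by (simp add: monom_0)
next
  case (Suc n)
  then show ?case by (simp add: monom_Suc cscale_0_left cscale_map_prod lin)
qed

lemma poly_act_mult: "poly_act A (p * q) w = poly_act A p (poly_act A q w)"
  by (induction p)
     (auto simp: poly_act_add poly_act_smult cscale_0_left)

lemma poly_act_add_right: "poly_act A p (w + w') = poly_act A p w + poly_act A p w'"
  by (induction p) (auto simp: cscale_add_right linear_add[OF linear_map_prod[OF lin]])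

text \<open>Scaling by \<open>c\<close> is the action of the constant polynomial
  \<open>[:c:]\<close>, so this is inherited from commutativity of polynomial
  multiplication.\<close>

lemma poly_act_cscale: "poly_act A p (cscale c w) = cscale c (poly_act A p w)"
proof -
  have "poly_act A p (cscale c w) = poly_act A (p * [:c:]) w"
    using linear_0[OF linear_map_prod[OF lin]] by (simp only: poly_act_mult) simp
  also have "\<dots> = poly_act A ([:c:] * p) w" by (simp only: mult.commute)
  also have "\<dots> = cscale c (poly_act A p w)"
    using linear_0[OF linear_map_prod[OF lin]] by (simp add: poly_act_smult)
  finally show ?thesis .
qed

lemma poly_act_eigenvector:
  assumes "map_prod A A w = cscale l w"
  shows "poly_act A p w = cscale (poly p l) w"
  by (induction p)
     (auto simp: cscale_0_left cscale_add_left cscale_map_prod lin assms mult.commute simp flip: cscale_mult)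

end

section \<open>Eigenvalues and annihilating polynomials\<close>

lemma eigenvalues_iff:
  "l \<in> eigenvalues A \<longleftrightarrow> (\<exists>w. w \<noteq> 0 \<and> map_prod A A w = cscale l w)"
  by (auto simp: eigenvalues_def cscale_def prod_eq_iff)

text \<open>Stated for a sequence because iterates of a map may repeat: distinct values are too many
  to be independent, and a repetition \<open>f i = f j\<close> is itself a relation.\<close>

lemma linear_relation_sequence:
  fixes f :: "nat \<Rightarrow> 'a::euclidean_space"
  shows "\<exists>c. (\<exists>i\<le>DIM('a). c i \<noteq> 0) \<and> (\<Sum>i\<le>DIM('a). c i *\<^sub>R f i) = 0"
proof (cases "inj_on f {..DIM('a)}")
  case True
  then have "dependent (f ` {..DIM('a)})"
    by (intro dependent_biggerset) (auto simp: card_image)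
  then obtain u where u: "\<exists>v\<in>f ` {..DIM('a)}. u v \<noteq> 0" "(\<Sum>v\<in>f ` {..DIM('a)}. u v *\<^sub>R v) = 0"
    by (subst (asm) real_vector.dependent_finite) auto
  show ?thesis
    using u by (intro exI[of _ "u \<circ> f"]) (auto simp: sum.reindex True)
next
  case False
  then obtain i j where ij: "i \<le> DIM('a)" "j \<le> DIM('a)" "i \<noteq> j" "f i = f j"
    by (auto simp: inj_on_def)
  have "(\<Sum>k\<le>DIM('a). (if k = i then 1 else if k = j then - 1 else 0) *\<^sub>R f k)
      = (\<Sum>k\<le>DIM('a). (if k = i then f k else 0) - (if k = j then f k else 0))"
    using ij by (intro sum.cong) auto
  also have "\<dots> = 0"
    using ij by (simp add: sum_subtractf)
  finally show ?thesis
    using ij by (intro exI[of _ "\<lambda>k. if k = i then 1 else if k = j then - 1 else 0"]) auto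
qed

lemma annihilating_poly_vector:
  fixes A :: "'a::euclidean_space \<Rightarrow> 'a"
  assumes "linear A"
  shows "\<exists>p. p \<noteq> 0 \<and> poly_act A p w = 0"
proof -
  obtain c i where c: "i \<le> DIM('a \<times> 'a)" "c i \<noteq> 0"
    "(\<Sum>i\<le>DIM('a \<times> 'a). c i *\<^sub>R (map_prod A A ^^ i) w) = 0"
    using linear_relation_sequence[of "\<lambda>i. (map_prod A A ^^ i) w"] by blast
  define p where "p = (\<Sum>i\<le>DIM('a \<times> 'a). monom (complex_of_real (c i)) i)"
  have "coeff p i \<noteq> 0"
    using c(1,2) by (simp add: p_def coeff_sum)
  then have "p \<noteq> 0" by auto
  moreover have "poly_act A p w = 0"
    using c(3) by (simp add: p_def poly_act_sum[OF assms] poly_act_monom[OF assms] cscale_of_real)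
  ultimately show ?thesis by blast
qed

text \<open>Polynomials in \<open>A\<close> commute, so a product of annihilators of single vectors
  kills all of these vectors. As p(A) is real linear, the \<open>Basis\<close> of the pair space
  suffices.\<close>

lemma annihilating_poly:
  fixes A :: "'a::euclidean_space \<Rightarrow> 'a"
  assumes "linear A"
  shows "\<exists>p. p \<noteq> 0 \<and> (\<forall>w. poly_act A p w = 0)"
proof -
  have *: "\<exists>p. p \<noteq> 0 \<and> (\<forall>w\<in>B. poly_act A p w = 0)" if "finite B" for B :: "('a \<times> 'a) set"
    using that
  proof (induction B)
    case empty
    show ?case by (intro exI[of _ 1]) auto
  next
    case (insert w B)
    then obtain p where p: "p \<noteq> 0" "\<forall>w\<in>B. poly_act A p w = 0" by blast
    obtain q where q: "q \<noteq> 0" "poly_act A q w = 0"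
      using annihilating_poly_vector[OF assms] by blast
    have 0: "poly_act A r 0 = 0" for r
      using poly_act_cscale[OF assms, of r 0 0] by (simp add: cscale_0_left)
    have "poly_act A (p * q) w = 0"
      by (simp add: poly_act_mult[OF assms] q 0)
    moreover have "poly_act A (p * q) v = 0" if "v \<in> B" for v
      by (subst mult.commute) (simp add: poly_act_mult[OF assms] p that 0)
    ultimately show ?case
      using p(1) q(1) by (intro exI[of _ "p * q"]) auto
  qed
  obtain p where p: "p \<noteq> 0" "\<And>b. b \<in> Basis \<Longrightarrow> poly_act A p b = 0"
    using *[OF finite_Basis] by blast
  have lin: "linear (poly_act A p)"
    by (intro linearI)
       (simp_all add: poly_act_add_right[OF assms] poly_act_cscale[OF assms] flip: cscale_of_real)
  have "poly_act A p = (\<lambda>_. 0)"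
    by (rule linear_eq_stdbasis) (use lin p linear_zero in auto)
  then show ?thesis using p(1) by auto
qed

text \<open>Every eigenvalue is a root of one annihilating polynomial. Finiteness makes the
  \<open>Max\<close> in \<open>gamma\<close> a genuine maximum.\<close>

lemma finite_eigenvalues:
  assumes "linear A"
  shows "finite (eigenvalues A)"
proof -
  obtain p where p: "p \<noteq> 0" "\<And>w. poly_act A p w = 0"
    using annihilating_poly[OF assms] by blast
  have "eigenvalues A \<subseteq> {l. poly p l = 0}"
  proof
    fix l assume "l \<in> eigenvalues A"
    then obtain w where w: "w \<noteq> 0" "map_prod A A w = cscale l w"
      by (auto simp only: eigenvalues_iff)
    then have "cscale (poly p l) w = 0"
      using poly_act_eigenvector[OF assms w(2), of p] p(2) by simp
    then show "l \<in> {l. poly p l = 0}" using w(1) by (simp add: cscale_eq_0_iff)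
  qed
  then show ?thesis using poly_roots_finite[OF p(1)] finite_subset by blast
qed

section \<open>Geometric bounds on powers\<close>

lemma linear_funpow:
  fixes A :: "'a::real_vector \<Rightarrow> 'a"
  assumes "linear A"
  shows "linear (A ^^ n)"
proof (induction n)
  case 0
  show ?case by (rule linearI) auto
next
  case (Suc n)
  then show ?case unfolding funpow.simps(2) using linear_compose[OF _ assms] by blast
qed

text \<open>The strict gap between \<open>l\<close> and \<open>r\<close> absorbs into a constant the
  polynomial growth that Jordan blocks would cause.\<close>

lemma recursive_bound:
  fixes u :: "nat \<Rightarrow> real"
  assumes "\<And>n. u (Suc n) \<le> l * u n + C * r ^ n" and "0 \<le> l" "l < r"
  shows "\<exists>C'. \<forall>n. u n \<le> C' * r ^ n"
proof -
  \<comment> \<open>The second entry is the least value with \<open>l * C' + C \<le> r * C'\<close>,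
    which closes the induction.\<close>
  define C' where "C' = max (u 0) (C / (r - l))"
  have C': "C \<le> C' * (r - l)"
    using assms(3) by (simp add: C'_def flip: pos_divide_le_eq)
  have "u n \<le> C' * r ^ n" for n
  proof (induction n)
    case 0
    show ?case by (simp add: C'_def)
  next
    case (Suc n)
    have "u (Suc n) \<le> l * (C' * r ^ n) + C * r ^ n"
      using assms(1)[of n] mult_left_mono[OF Suc assms(2)] by linarith
    also have "\<dots> \<le> l * (C' * r ^ n) + C' * (r - l) * r ^ n"
      using C' assms(2,3) by (intro add_left_mono mult_right_mono) auto
    also have "\<dots> = C' * r ^ Suc n" by (simp add: algebra_simps)
    finally show ?case .
  qed
  then show ?thesis by blast
qed

text \<open>Splitting off one linear factor \<open>X - l\<close> of an annihilating polynomial: either \<open>l\<close> is small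
  and the powers on \<open>w\<close> are controlled by those on \<open>(A - l) w\<close>, or \<open>l\<close> is not an eigenvalue
  and the factor can be dropped.\<close>

lemma power_bound_vector:
  fixes A :: "'a::euclidean_space \<Rightarrow> 'a"
  assumes lin: "linear A" and ev: "\<And>l. l \<in> eigenvalues A \<Longrightarrow> cmod l < r"
  assumes "p \<noteq> 0" "poly_act A p w = 0"
  shows "\<exists>C. \<forall>n. norm ((map_prod A A ^^ n) w) \<le> C * r ^ n"
  using assms(3,4)
proof (induction "degree p" arbitrary: p w)
  case 0
  then obtain c where "p = [:c:]" "c \<noteq> 0"
    by (metis degree_eq_zeroE pCons_0_0)
  then have "w = 0"
    using 0 linear_0[OF linear_map_prod[OF lin]] by (simp add: poly_act_pCons[OF lin] poly_act_0[OF lin] cscale_eq_0_iff)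
  have "(map_prod A A ^^ n) w = 0" for n
    by (induction n) (use \<open>w = 0\<close> linear_0[OF linear_map_prod[OF lin]] in auto)
  then show ?case by (intro exI[of _ 0]) auto
next
  case (Suc d)
  have "\<not> constant (poly p)" using Suc.hyps(2) by (simp add: constant_degree)
  then obtain l where "poly p l = 0" using fundamental_theorem_of_algebra by blast
  then obtain q where q: "p = [:- l, 1:] * q" by (auto simp: poly_eq_0_iff_dvd)
  have "q \<noteq> 0" using q Suc.prems by auto
  then have deg: "d = degree q"
    using Suc.hyps(2) unfolding q by (subst (asm) degree_mult_eq) auto
  let ?L = "map_prod A A"
  have X: "poly_act A [:- l, 1:] v = ?L v - cscale l v" for v
    using linear_0[OF linear_map_prod[OF lin]]
    by (simp add: poly_act_pCons[OF lin] poly_act_0[OF lin] cscale_1 cscale_minus_left)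
  show ?case
  proof (cases "cmod l < r")
    case True
    define v where "v = ?L w - cscale l w"
    have "poly_act A q v = 0"
      using Suc.prems(2) unfolding q v_def
      by (subst (asm) mult.commute) (simp only: poly_act_mult[OF lin] X)
    with Suc.hyps(1)[OF deg \<open>q \<noteq> 0\<close>] obtain C where
      C: "norm ((?L ^^ n) v) \<le> C * r ^ n" for n by blast
    have step: "norm ((?L ^^ Suc n) w) \<le> cmod l * norm ((?L ^^ n) w) + C * r ^ n" for n
    proof -
      have "(?L ^^ Suc n) w = cscale l ((?L ^^ n) w) + (?L ^^ n) v"
      proof (induction n)
        case (Suc n)
        have "(?L ^^ Suc (Suc n)) w = ?L (cscale l ((?L ^^ n) w) + (?L ^^ n) v)"
          unfolding Suc[symmetric] by simp
        then show ?case
          by (simp add: linear_add[OF linear_map_prod[OF lin]] cscale_map_prod[OF lin])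
      qed (simp add: v_def)
      then show ?thesis
        using C[of n] norm_triangle_ineq[of "cscale l ((?L ^^ n) w)" "(?L ^^ n) v"]
        by (simp add: norm_cscale)
    qed
    show ?thesis
      by (rule recursive_bound[where u = "\<lambda>n. norm ((?L ^^ n) w)", OF step _ True]) simp
  next
    case False
    \<comment> \<open>A nonzero q(A) w would be an eigenvector for \<open>l\<close>.\<close>
    have "?L (poly_act A q w) = cscale l (poly_act A q w)"
      using Suc.prems(2) unfolding q by (simp only: poly_act_mult[OF lin] X) simp
    moreover have "l \<notin> eigenvalues A" using ev False by blast
    ultimately have "poly_act A q w = 0" unfolding eigenvalues_iff by blast
    with Suc.hyps(1)[OF deg \<open>q \<noteq> 0\<close>] show ?thesis by blast
  qed
qed

text \<open>A real vector \<open>x\<close> is the pair \<open>(x, 0)\<close>. The constants for the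
  single basis vectors add up to one that is uniform in \<open>x\<close>.\<close>

lemma power_bound:
  fixes A :: "'a::euclidean_space \<Rightarrow> 'a"
  assumes lin: "linear A" and ev: "\<And>l. l \<in> eigenvalues A \<Longrightarrow> cmod l < r"
  shows "\<exists>C. \<forall>n x. norm ((A ^^ n) x) \<le> C * r ^ n * norm x"
proof -
  have "\<exists>C. \<forall>n. norm ((A ^^ n) x) \<le> C * r ^ n" for x
  proof -
    obtain p where "p \<noteq> 0" "poly_act A p (x, 0) = 0"
      using annihilating_poly_vector[OF lin] by blast
    then obtain C where C: "norm ((map_prod A A ^^ n) (x, 0)) \<le> C * r ^ n" for n
      using power_bound_vector[OF lin ev] by blast
    have "(map_prod A A ^^ n) (x, 0) = ((A ^^ n) x, 0)" for n
      by (induction n) (auto simp: linear_0[OF lin])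
    then show ?thesis using C by (intro exI[of _ C]) (auto simp: norm_Pair)
  qed
  then obtain C where C: "norm ((A ^^ n) x) \<le> C x * r ^ n" for n x by metis
  have "norm ((A ^^ n) x) \<le> (\<Sum>b\<in>Basis. C b) * r ^ n * norm x" for n x
  proof -
    note linn = linear_funpow[OF lin, of n]
    have "norm ((A ^^ n) x) = norm (\<Sum>b\<in>Basis. (x \<bullet> b) *\<^sub>R (A ^^ n) b)"
      by (subst (1) euclidean_representation[of x, symmetric])
         (simp only: linear_sum[OF linn] linear_scale[OF linn])
    also have "\<dots> \<le> (\<Sum>b\<in>Basis. norm x * (C b * r ^ n))"
      by (intro sum_norm_le) (auto intro!: mult_mono C Basis_le_norm)
    finally show ?thesis by (simp add: sum_distrib_left sum_distrib_right algebra_simps)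
  qed
  then show ?thesis by blast
qed

section \<open>Straightening a manifold onto its tangent space\<close>

lemma proj_eq_closest_point: "proj = closest_point"
  by (simp add: fun_eq_iff proj_def closest_point_def)

lemma proj_subspace_eqI:
  assumes "subspace T" "y \<in> T" "\<And>v. v \<in> T \<Longrightarrow> (x - y) \<bullet> v = 0"
  shows "proj T x = y"
proof -
  have "dist x y \<le> dist x z" if "z \<in> T" for z
  proof -
    have "(x - y) \<bullet> (y - z) = 0" using assms that by (simp add: subspace_diff)
    then have "norm (x - z) ^ 2 = norm (x - y) ^ 2 + norm (y - z) ^ 2"
      using norm_add_Pythagorean[of "x - y" "y - z"] by (simp add: orthogonal_def)
    then have "norm (x - y) ^ 2 \<le> norm (x - z) ^ 2" by simp
    then show ?thesis by (simp add: dist_norm)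
  qed
  then show ?thesis
    using closest_point_unique[of T y x] assms subspace_imp_convex[of T] closed_subspace[of T]
    by (auto simp: proj_eq_closest_point)
qed

context
  fixes T :: "'a::euclidean_space set"
  assumes T: "subspace T"
begin

lemma proj_subspace_in: "proj T x \<in> T"
  and proj_subspace_orth: "v \<in> T \<Longrightarrow> (x - proj T x) \<bullet> v = 0"
proof -
  obtain y z where yz: "y \<in> span T" "\<And>w. w \<in> span T \<Longrightarrow> orthogonal z w" "x = y + z"
    using orthogonal_subspace_decomp_exists by blast
  have "span T = T" using T by (simp only: span_eq_iff)
  with yz have y: "y \<in> T" "\<And>v. v \<in> T \<Longrightarrow> (x - y) \<bullet> v = 0"
    by (simp_all only: orthogonal_def) simp
  then have "proj T x = y" using proj_subspace_eqI[OF T] by blast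
  then show "proj T x \<in> T" "v \<in> T \<Longrightarrow> (x - proj T x) \<bullet> v = 0" using y by auto
qed

lemma proj_subspace_self: "x \<in> T \<Longrightarrow> proj T x = x"
  by (rule proj_subspace_eqI[OF T]) auto

lemma linear_proj: "linear (proj T)"
proof (rule linearI)
  fix x y c
  have "(x + y - (proj T x + proj T y)) \<bullet> v = (x - proj T x) \<bullet> v + (y - proj T y) \<bullet> v" for v
    by (simp add: algebra_simps)
  then show "proj T (x + y) = proj T x + proj T y"
    by (intro proj_subspace_eqI[OF T])
       (auto simp: proj_subspace_in proj_subspace_orth subspace_add T)
  have "(c *\<^sub>R x - c *\<^sub>R proj T x) \<bullet> v = c * ((x - proj T x) \<bullet> v)" for v
    by (simp add: algebra_simps)
  then show "proj T (c *\<^sub>R x) = c *\<^sub>R proj T x"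
    by (intro proj_subspace_eqI[OF T])
       (auto simp: proj_subspace_in proj_subspace_orth subspace_scale T)
qed

lemma norm_proj_subspace:
  "norm x ^ 2 = norm (proj T x) ^ 2 + norm (x - proj T x) ^ 2"
  using norm_add_Pythagorean[of "x - proj T x" "proj T x"]
    proj_subspace_orth[OF proj_subspace_in] by (simp add: orthogonal_def)

lemma norm_proj_residual_le:
  assumes "y \<in> T"
  shows "norm (x - proj T x) \<le> norm (x - y)"
  using closest_point_le[OF closed_subspace[OF T] assms, of x]
  by (simp add: proj_eq_closest_point dist_norm)

end

section \<open>Strict differentiability and straightening maps\<close>

lemma Ck_on_imp_C1_on:
  assumes "Ck_on k U f" "k \<ge> 1"
  shows "Ck_on 1 U f"
proof -
  have *: "Ck_on j U g \<Longrightarrow> continuous_on U g" for j g by (cases j) auto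
  show ?thesis using assms by (cases k) (auto simp: *)
qed

lemma linear_norm_le_sum_Basis:
  fixes A :: "'a::euclidean_space \<Rightarrow> 'b::real_normed_vector"
  assumes "linear A"
  shows "norm (A h) \<le> (\<Sum>i\<in>Basis. norm (A i)) * norm h"
proof -
  have "norm (A h) = norm (\<Sum>i\<in>Basis. (h \<bullet> i) *\<^sub>R A i)"
    by (subst (1) euclidean_representation[of h, symmetric])
       (simp only: linear_sum[OF assms] linear_scale[OF assms])
  also have "\<dots> \<le> (\<Sum>i\<in>Basis. norm (A i) * norm h)"
  proof (rule sum_norm_le)
    fix i :: 'a assume "i \<in> Basis"
    from mult_right_mono[OF Basis_le_norm[OF this, of h] norm_ge_zero[of "A i"]]
    show "norm ((h \<bullet> i) *\<^sub>R A i) \<le> norm (A i) * norm h" by (simp add: mult.commute)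
  qed
  finally show ?thesis by (simp add: sum_distrib_right)
qed

text \<open>Mean value inequality for \<open>f\<close> minus its linear part at \<open>x\<close>,
  whose derivative is small near \<open>x\<close> by continuity of the partial derivatives.\<close>

lemma C1_strict_derivative:
  fixes f :: "'a::euclidean_space \<Rightarrow> real"
  assumes C1: "Ck_on 1 U f" and "open U" "x \<in> U" "0 < e"
  shows "\<exists>d>0. \<forall>y\<in>ball x d. \<forall>z\<in>ball x d.
           norm (f y - f z - frechet_derivative f (at x) (y - z)) \<le> e * norm (y - z)"
proof -
  let ?D = "\<lambda>y. frechet_derivative f (at y)"
  have der: "(f has_derivative ?D y) (at y)" if "y \<in> U" for y
    using C1 that \<open>open U\<close> by (simp add: differentiable_on_eq_differentiable_at frechet_derivative_works)
  then have lin: "linear (?D y)" if "y \<in> U" for y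
    using that has_derivative_linear by blast
  have cont: "continuous_on U (\<lambda>y. ?D y i)" if "i \<in> Basis" for i
    using C1 that by simp
  \<comment> \<open>This sum dominates the operator norm of the difference of the
    derivatives.\<close>
  have "continuous_on U (\<lambda>y. \<Sum>i\<in>Basis. norm (?D y i - ?D x i))"
    by (intro continuous_intros cont)
  then have "isCont (\<lambda>y. \<Sum>i\<in>Basis. norm (?D y i - ?D x i)) x"
    using \<open>open U\<close> \<open>x \<in> U\<close> by (simp add: continuous_on_eq_continuous_at)
  then obtain d1 where d1: "d1 > 0"
    "\<And>y. dist y x < d1 \<Longrightarrow> \<bar>\<Sum>i\<in>Basis. norm (?D y i - ?D x i)\<bar> < e"
    using \<open>0 < e\<close> unfolding continuous_at_eps_delta by (force simp: dist_real_def)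
  obtain d2 where d2: "d2 > 0" "ball x d2 \<subseteq> U"
    using \<open>open U\<close> \<open>x \<in> U\<close> open_contains_ball by blast
  define d where "d = min d1 d2"
  have "norm (f y - f z - ?D x (y - z)) \<le> e * norm (y - z)"
    if "y \<in> ball x d" "z \<in> ball x d" for y z
  proof -
    have U: "w \<in> U" if "w \<in> ball x d" for w using that d2 by (auto simp: d_def)
    have "norm ((\<lambda>w. f w - ?D x w) y - (\<lambda>w. f w - ?D x w) z) \<le> e * norm (y - z)"
    proof (rule differentiable_bound[OF convex_ball _ _ that])
      fix w assume w: "w \<in> ball x d"
      have "((\<lambda>w. f w - ?D x w) has_derivative (\<lambda>h. ?D w h - ?D x h)) (at w)"
        by (intro has_derivative_diff der U w linear_imp_has_derivative lin \<open>x \<in> U\<close>)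
      then show "((\<lambda>w. f w - ?D x w) has_derivative (\<lambda>h. ?D w h - ?D x h)) (at w within ball x d)"
        by (rule has_derivative_at_withinI)
      have *: "(\<Sum>i\<in>Basis. norm (?D w i - ?D x i)) \<le> e"
        using d1(2)[of w] w by (auto simp: d_def dist_commute)
      show "onorm (\<lambda>h. ?D w h - ?D x h) \<le> e"
      proof (rule onorm_le)
        fix h
        have "norm (?D w h - ?D x h) \<le> (\<Sum>i\<in>Basis. norm (?D w i - ?D x i)) * norm h"
          by (rule linear_norm_le_sum_Basis) (intro linear_compose_sub lin U w \<open>x \<in> U\<close>)
        also have "\<dots> \<le> e * norm h" using * by (intro mult_right_mono) auto
        finally show "norm (?D w h - ?D x h) \<le> e * norm h" .
      qed
    qed
    then show ?thesis by (simp add: linear_diff[OF lin[OF \<open>x \<in> U\<close>]] algebra_simps)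
  qed
  then show ?thesis using d1(1) d2(1) by (intro exI[of _ d]) (auto simp: d_def)
qed

text \<open>A chart flattening \<open>M\<close> to \<open>T\<close>, strictly differentiable at
  \<open>x\<close> with derivative the identity. Besides closedness and nonemptiness, this is all
  that the nearest-point estimates use of \<open>M\<close>.\<close>

definition straightens ::
  "('a::euclidean_space \<Rightarrow> 'a) \<Rightarrow> 'a set \<Rightarrow> 'a \<Rightarrow> 'a set \<Rightarrow> bool" where
  "straightens \<Psi> M x T \<longleftrightarrow> subspace T \<and>
     (\<forall>e>0. \<exists>d>0. \<forall>y\<in>ball x d. \<forall>z\<in>ball x d. norm (\<Psi> y - \<Psi> z - (y - z)) \<le> e * norm (y - z)) \<and>
     (\<exists>d>0. \<forall>y\<in>ball x d. y \<in> M \<longleftrightarrow> \<Psi> y \<in> T)"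

text \<open>Weighting the gradients \<open>g i\<close> by the values \<open>F i\<close> gives a normal component orthogonal to the
  tangential one, so the derivative \<open>A\<close> of the sum \<open>\<Phi>\<close> is injective without choosing a dual basis;
  its inverse \<open>B\<close> fixes \<open>T\<close> pointwise and normalizes the derivative to the identity.\<close>

lemma local_defining_fun_straightens:
  fixes M :: "'a::euclidean_space set"
  assumes "local_defining_fun 1 M x U F m"
  shows "\<exists>\<Psi>. straightens \<Psi> M x {v. \<forall>i<m. frechet_derivative (F i) (at x) v = 0}"
proof -
  let ?D = "\<lambda>i. frechet_derivative (F i) (at x)"
  let ?T = "{v. \<forall>i<m. ?D i v = 0}"
  have U: "open U" "x \<in> U" and C1: "\<And>i. i < m \<Longrightarrow> Ck_on 1 U (F i)"
    and indep: "\<And>c. \<lbrakk>\<And>v. (\<Sum>i<m. c i * ?D i v) = 0\<rbrakk> \<Longrightarrow> \<forall>i<m. c i = 0"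
    and M: "M \<inter> U = {y \<in> U. \<forall>i<m. F i y = 0}"
    using assms unfolding local_defining_fun_def by auto
  have linD: "linear (?D i)" if "i < m" for i
    using C1[OF that] U
    by (auto simp: differentiable_on_eq_differentiable_at intro!: linear_frechet_derivative)
  define g where "g i = (\<Sum>b\<in>Basis. ?D i b *\<^sub>R b)" for i
  have g: "?D i v = g i \<bullet> v" if "i < m" for i v
  proof -
    have "?D i v = (\<Sum>b\<in>Basis. (v \<bullet> b) *\<^sub>R ?D i b)"
      by (subst (1) euclidean_representation[of v, symmetric])
         (simp only: linear_sum[OF linD[OF that]] linear_scale[OF linD[OF that]])
    then show ?thesis by (simp only: g_def inner_sum_left inner_scaleR_left) (simp add: inner_commute mult.commute)
  qed
  have T: "subspace ?T"
    by (auto intro!: subspaceI simp: g inner_add_right)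
  define G where "G c = (\<Sum>i<m. c i *\<^sub>R g i)" for c :: "nat \<Rightarrow> real"
  have G_orth: "G c \<bullet> v = 0" if "v \<in> ?T" for c v
    using that by (simp add: G_def inner_sum_left g)
  \<comment> \<open>A vector both normal and tangent is orthogonal to itself, hence zero;
    independence of the derivatives then kills the coefficients.\<close>
  have G_eq_0: "\<forall>i<m. c i = 0" if "G c \<in> ?T" for c
  proof (rule indep)
    fix v
    have "G c = 0" using G_orth[OF that, of c] by simp
    then have "(\<Sum>i<m. c i *\<^sub>R g i) \<bullet> v = 0" by (simp add: G_def)
    then show "(\<Sum>i<m. c i * ?D i v) = 0" by (simp add: inner_sum_left g)
  qed
  define A where "A v = proj ?T v + G (\<lambda>i. ?D i v)" for v
  have linA: "linear A"
  proof (rule linearI)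
    fix u v c
    show "A (u + v) = A u + A v"
      by (simp add: A_def G_def linear_add[OF linear_proj[OF T]] linear_add[OF linD]
          scaleR_add_left sum.distrib)
    show "A (c *\<^sub>R u) = c *\<^sub>R A u"
      by (simp add: A_def G_def linear_scale[OF linear_proj[OF T]] linear_scale[OF linD]
          scaleR_add_right scaleR_sum_right)
  qed
  have "v = 0" if "A v = 0" for v
  proof -
    have "proj ?T v = - G (\<lambda>i. ?D i v)"
      using that by (simp add: A_def add_eq_0_iff)
    then have "G (\<lambda>i. ?D i v) \<in> ?T"
      using subspace_neg[OF T proj_subspace_in[OF T, of v]] by simp
    from G_eq_0[OF this] have v: "v \<in> ?T" by blast
    then have "G (\<lambda>i. ?D i v) = 0" by (simp add: G_def)
    then show ?thesis using that proj_subspace_self[OF T v] by (simp add: A_def)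
  qed
  then have "inj A" using linear_injective_0[OF linA] by blast
  then obtain B where linB: "linear B" and B: "\<And>v. B (A v) = v" "\<And>v. A (B v) = v"
    using linear_injective_isomorphism[OF linA] by blast
  have A_id: "A v = v" if "v \<in> ?T" for v
    using that proj_subspace_self[OF T that] by (simp add: A_def G_def)
  have B_T: "B v \<in> ?T \<longleftrightarrow> v \<in> ?T" for v
    using A_id[of v] A_id[of "B v"] B(1)[of v] B(2)[of v] by auto
  define \<Phi> where "\<Phi> y = proj ?T (y - x) + G (\<lambda>i. F i y)" for y
  have \<Phi>_T: "\<Phi> y \<in> ?T \<longleftrightarrow> (\<forall>i<m. F i y = 0)" for y
  proof
    assume "\<Phi> y \<in> ?T"
    from subspace_diff[OF T this proj_subspace_in[OF T, of "y - x"]]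
    have "G (\<lambda>i. F i y) \<in> ?T" by (simp only: \<Phi>_def add_diff_cancel_left')
    then show "\<forall>i<m. F i y = 0" by (rule G_eq_0)
  next
    assume "\<forall>i<m. F i y = 0"
    then have "\<Phi> y = proj ?T (y - x)" by (simp add: \<Phi>_def G_def)
    then show "\<Phi> y \<in> ?T" using proj_subspace_in[OF T, of "y - x"] by (simp only:)
  qed
  obtain K where K: "K > 0" "\<And>v. norm (B v) \<le> K * norm v"
    using linear_bounded_pos[OF linB] by blast
  have strict: "\<exists>d>0. \<forall>y\<in>ball x d. \<forall>z\<in>ball x d.
      norm (B (\<Phi> y) - B (\<Phi> z) - (y - z)) \<le> e * norm (y - z)" if "e > 0" for e
  proof -
    \<comment> \<open>\<open>K\<close> pays for applying \<open>B\<close>, the sum for combining the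
      gradients; the added 1 keeps the denominator positive when \<open>m = 0\<close>.\<close>
    define e' where "e' = e / (K * (1 + (\<Sum>i<m. norm (g i))))"
    have pos: "1 + (\<Sum>i<m. norm (g i)) > 0" by (intro add_pos_nonneg sum_nonneg) auto
    then have "e' > 0" using \<open>e > 0\<close> \<open>K > 0\<close> by (simp add: e'_def)
    have "\<forall>i. \<exists>d>0. i < m \<longrightarrow> (\<forall>y\<in>ball x d. \<forall>z\<in>ball x d.
        norm (F i y - F i z - ?D i (y - z)) \<le> e' * norm (y - z))"
    proof
      fix i
      show "\<exists>d>0. i < m \<longrightarrow> (\<forall>y\<in>ball x d. \<forall>z\<in>ball x d.
        norm (F i y - F i z - ?D i (y - z)) \<le> e' * norm (y - z))"
      proof (cases "i < m")
        case True
        show ?thesis using C1_strict_derivative[OF C1[OF True] U \<open>e' > 0\<close>] by blast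
      next
        case False
        show ?thesis using False zero_less_one by blast
      qed
    qed
    then obtain d where d: "\<And>i. d i > 0" "\<And>i y z. \<lbrakk>i < m; y \<in> ball x (d i); z \<in> ball x (d i)\<rbrakk> \<Longrightarrow>
        norm (F i y - F i z - ?D i (y - z)) \<le> e' * norm (y - z)"
      by metis
    define r where "r = Min (insert 1 (d ` {..<m}))"
    have r: "r > 0" "\<And>i. i < m \<Longrightarrow> r \<le> d i" using d(1) by (auto simp: r_def)
    have "norm (B (\<Phi> y) - B (\<Phi> z) - (y - z)) \<le> e * norm (y - z)"
      if "y \<in> ball x r" "z \<in> ball x r" for y z
    proof -
      \<comment> \<open>The tangential parts cancel by linearity of the projection; only the
        first-order remainders of the \<open>F i\<close> survive.\<close>
      have "\<Phi> y - \<Phi> z - A (y - z) = G (\<lambda>i. F i y - F i z - ?D i (y - z))"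
        by (simp add: \<Phi>_def A_def G_def linear_diff[OF linear_proj[OF T]] scaleR_diff_left sum_subtractf)
      also have "norm \<dots> \<le> (\<Sum>i<m. e' * norm (y - z) * norm (g i))"
        unfolding G_def
      proof (rule sum_norm_le)
        fix i assume "i \<in> {..<m}"
        then have "norm (F i y - F i z - ?D i (y - z)) \<le> e' * norm (y - z)"
          using that r(2)[of i] by (intro d(2)) auto
        then show "norm ((F i y - F i z - ?D i (y - z)) *\<^sub>R g i) \<le> e' * norm (y - z) * norm (g i)"
          by (simp add: mult_right_mono)
      qed
      also have "\<dots> \<le> e' * norm (y - z) * (1 + (\<Sum>i<m. norm (g i)))"
        using \<open>e' > 0\<close> by (simp add: sum_distrib_left algebra_simps)
      also have "\<dots> = e / K * norm (y - z)" using pos by (simp add: e'_def)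
      finally have *: "norm (\<Phi> y - \<Phi> z - A (y - z)) \<le> e / K * norm (y - z)" .
      have "norm (B (\<Phi> y) - B (\<Phi> z) - (y - z)) = norm (B (\<Phi> y - \<Phi> z - A (y - z)))"
        by (simp add: linear_diff[OF linB] B)
      also have "\<dots> \<le> K * (e / K * norm (y - z))"
        using K(2)[of "\<Phi> y - \<Phi> z - A (y - z)"] mult_left_mono[OF *, of K] K(1) by linarith
      finally show ?thesis using K(1) by simp
    qed
    then show ?thesis using r(1) by blast
  qed
  obtain d where d: "d > 0" "ball x d \<subseteq> U" using U open_contains_ball by blast
  have "y \<in> M \<longleftrightarrow> B (\<Phi> y) \<in> ?T" if "y \<in> ball x d" for y
    using M d(2) that B_T \<Phi>_T by blast
  then have "straightens (\<lambda>y. B (\<Phi> y)) M x ?T"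
    unfolding straightens_def using T strict d(1) by blast
  then show ?thesis by blast
qed

text \<open>\<open>tangent_space\<close> chooses the kernel belonging to some C1 defining function;
  the straightening map is built from that very function.\<close>

lemma tangent_space_straightens:
  assumes "Ck_manifold_around k M x" "k \<ge> 1"
  shows "\<exists>\<Psi>. straightens \<Psi> M x (tangent_space M x)"
proof -
  obtain U F m where "local_defining_fun k M x U F m"
    using assms(1) by (auto simp: Ck_manifold_around_def)
  then have "local_defining_fun 1 M x U F m"
    using Ck_on_imp_C1_on[OF _ assms(2)] unfolding local_defining_fun_def by blast
  then have "\<exists>T U F m. local_defining_fun 1 M x U F m \<and>
      T = {v. \<forall>i<m. frechet_derivative (F i) (at x) v = 0}" by blast
  from someI_ex[OF this] obtain U F m where ldf: "local_defining_fun 1 M x U F m"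
    and eq: "tangent_space M x = {v. \<forall>i<m. frechet_derivative (F i) (at x) v = 0}"
    unfolding tangent_space_def by blast
  then show ?thesis using local_defining_fun_straightens[OF ldf] by (simp only: eq)
qed

section \<open>Linearization of nearest-point maps\<close>

text \<open>The point \<open>q'\<close> solves \<open>\<Psi> q' = \<Psi> q + t *\<^sub>R v\<close>;
  the right side lies in \<open>T\<close>, so \<open>q'\<close> lies in \<open>M\<close>. Banach's
  theorem applies because \<Psi> differs from the identity by a map with Lipschitz constant at most
  1/2.\<close>

lemma straightens_lift:
  fixes M :: "'a::euclidean_space set"
  assumes str: "straightens \<Psi> M x T" and e: "0 < e" "e \<le> 1 / 2"
  shows "\<exists>d>0. \<forall>q\<in>M \<inter> ball x d. \<forall>v\<in>T. \<exists>s>0. \<forall>t. 0 < t \<and> t < s \<longrightarrow>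
           (\<exists>q'\<in>M. norm (q' - q - t *\<^sub>R v) \<le> e * norm (q' - q))"
proof -
  obtain d1 where d1: "d1 > 0" "\<And>y z. \<lbrakk>y \<in> ball x d1; z \<in> ball x d1\<rbrakk> \<Longrightarrow>
      norm (\<Psi> y - \<Psi> z - (y - z)) \<le> e * norm (y - z)"
    using str e(1) unfolding straightens_def by meson
  obtain d2 where d2: "d2 > 0" "\<And>y. y \<in> ball x d2 \<Longrightarrow> y \<in> M \<longleftrightarrow> \<Psi> y \<in> T"
    using str unfolding straightens_def by meson
  have T: "subspace T" using str by (simp add: straightens_def)
  define d where "d = min d1 d2"
  have "\<exists>s>0. \<forall>t. 0 < t \<and> t < s \<longrightarrow> (\<exists>q'\<in>M. norm (q' - q - t *\<^sub>R v) \<le> e * norm (q' - q))"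
    if q: "q \<in> M \<inter> ball x d" and v: "v \<in> T" for q v
  proof -
    define r where "r = (d - dist x q) / 2"
    have "r > 0" using q by (simp add: r_def)
    have sub: "cball q r \<subseteq> ball x d"
    proof
      fix y assume "y \<in> cball q r"
      then have "dist x y \<le> dist x q + r" using dist_triangle[of x y q] by simp
      then show "y \<in> ball x d" using q \<open>r > 0\<close> by (simp add: r_def field_simps)
    qed
    \<comment> \<open>Then t |v| is at most r/2, so with contraction factor 1/2 the map
      \<open>g\<close> sends \<open>cball q r\<close> into itself.\<close>
    define s where "s = r / (2 * (1 + norm v))"
    have pos: "1 + norm v > 0" by (simp add: add_pos_nonneg)
    have "s > 0" using \<open>r > 0\<close> pos by (simp add: s_def)
    moreover have "\<exists>q'\<in>M. norm (q' - q - t *\<^sub>R v) \<le> e * norm (q' - q)" if t: "0 < t" "t < s" for t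
    proof -
      have "t * norm v \<le> s * (1 + norm v)"
        using t by (intro mult_mono) auto
      also have "\<dots> = r / 2" using pos by (simp add: s_def field_simps)
      finally have tv: "t * norm v \<le> r / 2" .
      define g where "g z = z - \<Psi> z + (\<Psi> q + t *\<^sub>R v)" for z
      have contr: "norm (g y - g z) \<le> 1 / 2 * norm (y - z)" if "y \<in> cball q r" "z \<in> cball q r" for y z
      proof -
        have "norm (g y - g z) = norm (\<Psi> y - \<Psi> z - (y - z))"
          by (subst norm_minus_commute) (simp add: g_def algebra_simps)
        also have "\<dots> \<le> e * norm (y - z)" using that sub by (intro d1) (auto simp: d_def)
        also have "\<dots> \<le> 1 / 2 * norm (y - z)" using e by (intro mult_right_mono) auto
        finally show ?thesis .
      qed
      have q_in: "q \<in> cball q r" using \<open>r > 0\<close> by simp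
      have "g z \<in> cball q r" if z: "z \<in> cball q r" for z
      proof -
        have "norm (g z - q) \<le> norm (g z - g q) + norm (g q - q)"
          using norm_triangle_ineq[of "g z - g q" "g q - q"] by simp
        also have "\<dots> \<le> 1 / 2 * norm (z - q) + t * norm v"
          using contr[OF z q_in] t by (simp add: g_def)
        also have "\<dots> \<le> r" using z tv by (simp add: dist_norm norm_minus_commute)
        finally show ?thesis by (simp add: dist_norm norm_minus_commute)
      qed
      then have "g ` cball q r \<subseteq> cball q r" by blast
      then have "\<exists>!z. z \<in> cball q r \<and> g z = z"
        using \<open>r > 0\<close> contr
        by (intro Banach_fix[where c = "1/2"]) (auto simp: dist_norm complete_eq_closed)
      then obtain q' where q': "q' \<in> cball q r" "g q' = q'" by blast
      then have \<Psi>: "\<Psi> q' = \<Psi> q + t *\<^sub>R v" by (simp add: g_def)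
      have ball: "q' \<in> ball x d" using q'(1) sub by blast
      have "\<Psi> q \<in> T" using d2(2)[of q] q by (auto simp: d_def)
      then have "\<Psi> q' \<in> T" unfolding \<Psi> by (intro subspace_add subspace_scale T v)
      then have "q' \<in> M" using d2(2) ball by (simp add: d_def)
      moreover have "norm (\<Psi> q' - \<Psi> q - (q' - q)) \<le> e * norm (q' - q)"
        using ball q by (intro d1) (auto simp: d_def)
      then have "norm (q' - q - t *\<^sub>R v) \<le> e * norm (q' - q)"
        by (subst norm_minus_commute) (simp add: \<Psi> algebra_simps)
      ultimately show ?thesis by blast
    qed
    ultimately show ?thesis by blast
  qed
  moreover have "d > 0" using d1(1) d2(1) by (simp add: d_def)
  ultimately show ?thesis by blast
qed

text \<open>The first-order optimality condition at \<open>q\<close>, the nearest point of \<open>M\<close>: moving from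
  \<open>q\<close> within \<open>M\<close> almost in the direction of the tangential part of \<open>y - q\<close> cannot
  decrease the distance to \<open>y\<close>.\<close>

lemma residual_almost_normal:
  fixes M :: "'a::euclidean_space set"
  assumes str: "straightens \<Psi> M x T" and e: "0 < e" "e \<le> 1 / 2"
  shows "\<exists>d>0. \<forall>q\<in>M \<inter> ball x d. \<forall>y. (\<forall>z\<in>M. dist y q \<le> dist y z) \<longrightarrow>
           norm (proj T (y - q)) \<le> 2 * e * norm (y - q)"
proof -
  have T: "subspace T" using str by (simp add: straightens_def)
  obtain d where d: "d > 0" and lift: "\<forall>q\<in>M \<inter> ball x d. \<forall>v\<in>T. \<exists>s>0. \<forall>t. 0 < t \<and> t < s \<longrightarrow>
           (\<exists>q'\<in>M. norm (q' - q - t *\<^sub>R v) \<le> e * norm (q' - q))"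
    using straightens_lift[OF str e] by blast
  have "norm (proj T (y - q)) \<le> 2 * e * norm (y - q)"
    if q: "q \<in> M \<inter> ball x d" and min: "\<forall>z\<in>M. dist y q \<le> dist y z" for q y
  proof -
    define v where "v = proj T (y - q)"
    have v: "v \<in> T" using proj_subspace_in[OF T] by (simp add: v_def)
    have yv: "(y - q) \<bullet> v = norm v ^ 2"
      using proj_subspace_orth[OF T v, of "y - q"]
      by (simp add: v_def inner_diff_left power2_norm_eq_inner)
    obtain s where s: "s > 0" "\<And>t. 0 < t \<Longrightarrow> t < s \<Longrightarrow>
        \<exists>q'\<in>M. norm (q' - q - t *\<^sub>R v) \<le> e * norm (q' - q)"
      using lift q v by blast
    \<comment> \<open>Compare the squared distances from \<open>y\<close> to \<open>q\<close> and to
      \<open>q'\<close>, then divide by t |v|. The term in \<open>t\<close> stems from the square of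
      |q' - q|.\<close>
    have step: "norm v \<le> 2 * e * norm (y - q) + 2 * t * norm v" if t: "0 < t" "t < s" for t
    proof -
      obtain q' where q': "q' \<in> M" "norm (q' - q - t *\<^sub>R v) \<le> e * norm (q' - q)"
        using s(2)[OF t] by blast
      have "norm (q' - q) \<le> norm (q' - q - t *\<^sub>R v) + t * norm v"
        using norm_triangle_ineq[of "q' - q - t *\<^sub>R v" "t *\<^sub>R v"] t by simp
      moreover have "e * norm (q' - q) \<le> 1 / 2 * norm (q' - q)"
        using e by (intro mult_right_mono) auto
      ultimately have n: "norm (q' - q) \<le> 2 * (t * norm v)" using q'(2) by linarith
      then have "e * norm (q' - q) \<le> e * (2 * (t * norm v))"
        using e(1) by (intro mult_left_mono) auto
      then have dev: "norm (q' - q - t *\<^sub>R v) \<le> 2 * e * t * norm v" using q'(2) by simp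
      have "norm (y - q) ^ 2 \<le> norm (y - q') ^ 2"
        using min q'(1) by (simp add: dist_norm power_mono)
      also have "norm (y - q') ^ 2 = norm (y - q) ^ 2 - 2 * ((y - q) \<bullet> (q' - q)) + norm (q' - q) ^ 2"
        by (simp add: power2_norm_eq_inner algebra_simps inner_commute)
      finally have "2 * ((y - q) \<bullet> (q' - q)) \<le> norm (q' - q) ^ 2" by simp
      also have "\<dots> \<le> (2 * (t * norm v)) ^ 2" using n by (intro power_mono) auto
      finally have 1: "2 * ((y - q) \<bullet> (q' - q)) \<le> 4 * t ^ 2 * norm v ^ 2"
        by (simp add: power_mult_distrib)
      have 2: "(y - q) \<bullet> (q' - q) = t * norm v ^ 2 + (y - q) \<bullet> (q' - q - t *\<^sub>R v)"
        by (simp add: inner_diff_right[of _ _ "t *\<^sub>R v"] yv)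
      have "\<bar>(y - q) \<bullet> (q' - q - t *\<^sub>R v)\<bar> \<le> norm (y - q) * norm (q' - q - t *\<^sub>R v)"
        by (rule Cauchy_Schwarz_ineq2)
      also have "\<dots> \<le> norm (y - q) * (2 * e * t * norm v)"
        using dev by (intro mult_left_mono) auto
      finally have "t * norm v * norm v \<le> t * norm v * (2 * e * norm (y - q) + 2 * t * norm v)"
        using 1 2 by (simp add: algebra_simps power2_eq_square)
      then show ?thesis
        using t e(1) by (cases "v = 0") (auto simp: mult_le_cancel_left_pos)
    qed
    \<comment> \<open>Letting \<open>t\<close> tend to 0 from the right removes that last
      term.\<close>
    have "((\<lambda>t. 2 * e * norm (y - q) + 2 * t * norm v) \<longlongrightarrow> 2 * e * norm (y - q) + 2 * 0 * norm v)
        (at_right 0)"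
      by (intro tendsto_intros)
    moreover have "\<forall>\<^sub>F t in at_right 0. norm v \<le> 2 * e * norm (y - q) + 2 * t * norm v"
      unfolding eventually_at_right_field using s(1) step by blast
    ultimately have "norm v \<le> 2 * e * norm (y - q) + 2 * 0 * norm v"
      by (intro tendsto_lowerbound) auto
    then show ?thesis by (simp add: v_def)
  qed
  then show ?thesis using d by blast
qed

text \<open>Strict differentiability tested only on increments starting at fixed points of \<open>f\<close> in \<open>C\<close>:
  the nearest-point map of a \<open>C\<^sup>1\<close> manifold satisfies it although it need not be continuous.\<close>

definition linearizes_along ::
  "'a::euclidean_space set \<Rightarrow> 'a \<Rightarrow> ('a \<Rightarrow> 'a) \<Rightarrow> ('a \<Rightarrow> 'a) \<Rightarrow> bool" where
  "linearizes_along C x f L \<longleftrightarrow> linear L \<and>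
     (\<forall>e>0. \<exists>d>0. \<forall>y\<in>ball x d. \<forall>p\<in>C \<inter> ball x d. norm (f y - p - L (y - p)) \<le> e * norm (y - p))"

section \<open>Calculus of linearizations along a set\<close>

lemma linearizes_along_linear: "linearizes_along C x f L \<Longrightarrow> linear L"
  by (simp add: linearizes_along_def)

lemma linearizes_alongE:
  assumes "linearizes_along C x f L" "0 < e"
  obtains d where "d > 0" "\<And>y p. \<lbrakk>dist x y < d; p \<in> C; dist x p < d\<rbrakk> \<Longrightarrow>
    norm (f y - p - L (y - p)) \<le> e * norm (y - p)"
proof -
  obtain d where "d > 0" "\<forall>y\<in>ball x d. \<forall>p\<in>C \<inter> ball x d. norm (f y - p - L (y - p)) \<le> e * norm (y - p)"
    using assms unfolding linearizes_along_def by blast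
  then show ?thesis by (intro that[of d]) auto
qed

lemma linearizes_along_subset:
  assumes "linearizes_along C x f L" "C' \<subseteq> C"
  shows "linearizes_along C' x f L"
  using assms unfolding linearizes_along_def by (meson IntD1 IntD2 IntI subsetD)

lemma linearizes_along_id: "linearizes_along C x (\<lambda>y. y) (\<lambda>y. y)"
  unfolding linearizes_along_def by (auto intro: linearI exI[of _ 1])

lemma linearizes_along_convex_comb:
  assumes f: "linearizes_along C x f L" and g: "linearizes_along C x g K"
  shows "linearizes_along C x (\<lambda>y. (1 - a) *\<^sub>R f y + a *\<^sub>R g y) (\<lambda>y. (1 - a) *\<^sub>R L y + a *\<^sub>R K y)"
  unfolding linearizes_along_def
proof (intro conjI allI impI)
  show "linear (\<lambda>y. (1 - a) *\<^sub>R L y + a *\<^sub>R K y)"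
    by (intro linear_compose_add linear_compose_scale_right linearizes_along_linear[OF f]
        linearizes_along_linear[OF g])
  fix e :: real assume "e > 0"
  \<comment> \<open>The denominator is positive for every real \<open>a\<close>; relaxation
    parameters may exceed 1.\<close>
  define e' where "e' = e / (\<bar>1 - a\<bar> + \<bar>a\<bar>)"
  have pos: "\<bar>1 - a\<bar> + \<bar>a\<bar> > 0" by linarith
  then have "e' > 0" using \<open>e > 0\<close> by (simp add: e'_def)
  obtain d1 where d1: "d1 > 0" "\<And>y p. \<lbrakk>dist x y < d1; p \<in> C; dist x p < d1\<rbrakk> \<Longrightarrow>
    norm (f y - p - L (y - p)) \<le> e' * norm (y - p)" using linearizes_alongE[OF f \<open>e' > 0\<close>] by blast
  obtain d2 where d2: "d2 > 0" "\<And>y p. \<lbrakk>dist x y < d2; p \<in> C; dist x p < d2\<rbrakk> \<Longrightarrow>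
    norm (g y - p - K (y - p)) \<le> e' * norm (y - p)" using linearizes_alongE[OF g \<open>e' > 0\<close>] by blast
  have "norm ((1 - a) *\<^sub>R f y + a *\<^sub>R g y - p - ((1 - a) *\<^sub>R L (y - p) + a *\<^sub>R K (y - p)))
      \<le> e * norm (y - p)"
    if "y \<in> ball x (min d1 d2)" "p \<in> C \<inter> ball x (min d1 d2)" for y p
  proof -
    have "(1 - a) *\<^sub>R f y + a *\<^sub>R g y - p - ((1 - a) *\<^sub>R L (y - p) + a *\<^sub>R K (y - p))
        = (1 - a) *\<^sub>R (f y - p - L (y - p)) + a *\<^sub>R (g y - p - K (y - p))"
      by (simp add: algebra_simps)
    also have "norm \<dots> \<le> \<bar>1 - a\<bar> * norm (f y - p - L (y - p)) + \<bar>a\<bar> * norm (g y - p - K (y - p))"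
      by (rule norm_triangle_le) simp
    also have "\<dots> \<le> \<bar>1 - a\<bar> * (e' * norm (y - p)) + \<bar>a\<bar> * (e' * norm (y - p))"
      using that by (intro add_mono mult_left_mono d1(2) d2(2)) auto
    also have "\<dots> = (\<bar>1 - a\<bar> + \<bar>a\<bar>) * e' * norm (y - p)" by (simp add: algebra_simps)
    also have "\<dots> = e * norm (y - p)" using pos by (simp add: e'_def)
    finally show ?thesis .
  qed
  then show "\<exists>d>0. \<forall>y\<in>ball x d. \<forall>p\<in>C \<inter> ball x d.
      norm ((1 - a) *\<^sub>R f y + a *\<^sub>R g y - p - ((1 - a) *\<^sub>R L (y - p) + a *\<^sub>R K (y - p)))
        \<le> e * norm (y - p)"
    using d1(1) d2(1) by (intro exI[of _ "min d1 d2"]) auto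
qed

text \<open>Both expansions share the base point \<open>p\<close>, so f y - p is the increment for
  \<open>g\<close>, and the error of \<open>f\<close> passes through the bounded map
  \<open>K\<close>.\<close>

lemma linearizes_along_compose:
  assumes f: "linearizes_along C x f L" and g: "linearizes_along C x g K"
  shows "linearizes_along C x (\<lambda>y. g (f y)) (\<lambda>y. K (L y))"
  unfolding linearizes_along_def
proof (intro conjI allI impI)
  note linL = linearizes_along_linear[OF f] and linK = linearizes_along_linear[OF g]
  show "linear (\<lambda>y. K (L y))" using linear_compose[OF linL linK] by (simp add: o_def)
  fix e :: real assume "e > 0"
  obtain l where l: "l > 0" "\<And>v. norm (L v) \<le> l * norm v"
    using linear_bounded_pos[OF linL] by blast
  obtain k where k: "k > 0" "\<And>v. norm (K v) \<le> k * norm v"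
    using linear_bounded_pos[OF linK] by blast
  \<comment> \<open>The cap 1 yields |f y - p| <= (l + 1) |y - p|; the other entry keeps the error
    of \<open>f\<close>, after \<open>K\<close>, within half of \<open>e\<close>.\<close>
  define e1 where "e1 = min 1 (e / (2 * k))"
  have e1: "e1 > 0" "e1 \<le> 1" "k * e1 \<le> e / 2"
    using k(1) \<open>e > 0\<close> by (auto simp: e1_def min_def field_simps)
  define e2 where "e2 = e / (2 * (l + 1))"
  have e2: "e2 > 0" "e2 * (l + 1) = e / 2"
    using l(1) \<open>e > 0\<close> by (auto simp: e2_def field_simps)
  obtain d1 where d1: "d1 > 0" "\<And>y p. \<lbrakk>dist x y < d1; p \<in> C; dist x p < d1\<rbrakk> \<Longrightarrow>
    norm (f y - p - L (y - p)) \<le> e1 * norm (y - p)" using linearizes_alongE[OF f e1(1)] by blast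
  obtain d2 where d2: "d2 > 0" "\<And>y p. \<lbrakk>dist x y < d2; p \<in> C; dist x p < d2\<rbrakk> \<Longrightarrow>
    norm (g y - p - K (y - p)) \<le> e2 * norm (y - p)" using linearizes_alongE[OF g e2(1)] by blast
  \<comment> \<open>Keeps \<open>f y\<close> where \<open>g\<close> is controlled: its distance to
    \<open>x\<close> is below d + (l + 1) 2 d = (2 l + 3) d.\<close>
  define d where "d = min d1 (d2 / (2 * l + 3))"
  have "2 * l + 3 > 0" using l(1) by linarith
  then have d: "d > 0" "d \<le> d1" "d * (2 * l + 3) \<le> d2"
    using d1(1) d2(1) by (simp_all add: d_def flip: pos_le_divide_eq)
  have "norm (g (f y) - p - K (L (y - p))) \<le> e * norm (y - p)"
    if y: "y \<in> ball x d" and p: "p \<in> C \<inter> ball x d" for y p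
  proof -
    have dev: "norm (f y - p - L (y - p)) \<le> e1 * norm (y - p)"
      using y p d(2) by (intro d1(2)) auto
    have "norm (f y - p) \<le> norm (f y - p - L (y - p)) + norm (L (y - p))"
      using norm_triangle_ineq[of "f y - p - L (y - p)" "L (y - p)"] by simp
    also have "\<dots> \<le> 1 * norm (y - p) + l * norm (y - p)"
      using dev l(2)[of "y - p"] mult_right_mono[OF e1(2) norm_ge_zero[of "y - p"]] by linarith
    finally have fy: "norm (f y - p) \<le> (l + 1) * norm (y - p)" by (simp add: algebra_simps)
    have yp: "norm (y - p) < 2 * d"
      using y p dist_triangle[of y p x] by (simp add: dist_norm dist_commute norm_minus_commute)
    have "dist x (f y) \<le> dist x p + norm (f y - p)"
      using dist_triangle[of x "f y" p] by (simp add: dist_norm norm_minus_commute)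
    also have "\<dots> < d + (l + 1) * (2 * d)"
    proof -
      have "(l + 1) * norm (y - p) < (l + 1) * (2 * d)"
        using yp l(1) by (intro mult_strict_left_mono) auto
      moreover have "dist x p < d" using p by simp
      ultimately show ?thesis using fy by linarith
    qed
    also have "\<dots> \<le> d2" using d(3) by (simp add: algebra_simps)
    finally have fy_near: "dist x (f y) < d2" .
    have "d * 1 \<le> d * (2 * l + 3)" using l(1) d(1) by (intro mult_left_mono) auto
    then have p_near: "dist x p < d2" using p d(3) by simp
    have "g (f y) - p - K (L (y - p)) = (g (f y) - p - K (f y - p)) + K (f y - p - L (y - p))"
      by (simp add: linear_diff[OF linK])
    also have "norm \<dots> \<le> e2 * norm (f y - p) + k * norm (f y - p - L (y - p))"
      using p by (intro norm_triangle_le add_mono d2(2) k(2) fy_near p_near) auto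
    also have "\<dots> \<le> e2 * ((l + 1) * norm (y - p)) + k * (e1 * norm (y - p))"
      using fy dev e2(1) k(1) by (intro add_mono mult_left_mono) auto
    also have "\<dots> = (e2 * (l + 1)) * norm (y - p) + (k * e1) * norm (y - p)" by simp
    also have "\<dots> \<le> e / 2 * norm (y - p) + e / 2 * norm (y - p)"
      unfolding e2(2) using e1(3) by (intro add_mono mult_right_mono) auto
    finally show ?thesis by simp
  qed
  then show "\<exists>d>0. \<forall>y\<in>ball x d. \<forall>p\<in>C \<inter> ball x d.
      norm (g (f y) - p - K (L (y - p))) \<le> e * norm (y - p)"
    using d(1) by blast
qed

lemma linearizes_along_funpow:
  assumes "linearizes_along C x f L"
  shows "linearizes_along C x (f ^^ n) (L ^^ n)"
proof (induction n)
  case 0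
  show ?case using linearizes_along_id[of C x] by (simp add: id_def)
next
  case (Suc n)
  show ?case using linearizes_along_compose[OF Suc assms] by (simp add: o_def)
qed

text \<open>With q = proj M y, the error splits into the normal part of q - p, small because chords
  of \<open>M\<close> are almost tangent, and the tangential part of y - q, small by
  \<open>residual_almost_normal\<close>.\<close>

lemma linearizes_along_proj:
  fixes M :: "'a::euclidean_space set"
  assumes str: "straightens \<Psi> M x T" and "closed M" "M \<noteq> {}"
  shows "linearizes_along M x (proj M) (proj T)"
  unfolding linearizes_along_def
proof (intro conjI allI impI)
  have T: "subspace T" using str by (simp add: straightens_def)
  note linP = linear_proj[OF T]
  show "linear (proj T)" by (rule linP)
  fix e :: real assume "e > 0"
  define e' where "e' = min (e / 4) (1 / 2)"
  have e': "e' > 0" "e' \<le> 1 / 2" "4 * e' \<le> e" using \<open>e > 0\<close> by (auto simp: e'_def)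
  obtain d1 where d1: "d1 > 0" "\<And>y z. \<lbrakk>y \<in> ball x d1; z \<in> ball x d1\<rbrakk> \<Longrightarrow>
      norm (\<Psi> y - \<Psi> z - (y - z)) \<le> e' * norm (y - z)"
    using str e'(1) unfolding straightens_def by meson
  obtain d2 where d2: "d2 > 0" "\<And>y. y \<in> ball x d2 \<Longrightarrow> y \<in> M \<longleftrightarrow> \<Psi> y \<in> T"
    using str unfolding straightens_def by meson
  obtain d3 where d3: "d3 > 0" "\<And>q y. \<lbrakk>q \<in> M \<inter> ball x d3; \<forall>z\<in>M. dist y q \<le> dist y z\<rbrakk> \<Longrightarrow>
      norm (proj T (y - q)) \<le> 2 * e' * norm (y - q)"
    using residual_almost_normal[OF str e'(1,2)] by blast
  \<comment> \<open>As |y - q| <= |y - p| < 2 d, the nearest point \<open>q\<close> stays within 3 d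
    of \<open>x\<close>.\<close>
  define d where "d = min d1 (min d2 d3) / 3"
  have d: "d > 0" "3 * d \<le> d1" "3 * d \<le> d2" "3 * d \<le> d3"
    using d1(1) d2(1) d3(1) by (auto simp: d_def)
  have "norm (proj M y - p - proj T (y - p)) \<le> e * norm (y - p)"
    if y: "y \<in> ball x d" and p: "p \<in> M \<inter> ball x d" for y p
  proof -
    define q where "q = proj M y"
    have q: "q \<in> M" "\<forall>z\<in>M. dist y q \<le> dist y z"
      using assms(2,3) closest_point_in_set closest_point_le
      unfolding q_def proj_eq_closest_point by blast+
    have yq: "norm (y - q) \<le> norm (y - p)" using q(2) p by (simp add: dist_norm)
    have qp: "norm (q - p) \<le> 2 * norm (y - p)"
      using norm_triangle_ineq4[of "y - p" "y - q"] yq by simp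
    have "dist y p < 2 * d" using y p dist_triangle[of y p x] by (simp add: dist_commute)
    then have "dist x q < 3 * d"
      using y yq dist_triangle[of x q y] by (simp add: dist_norm)
    moreover have "dist x p < 3 * d" using p d(1) by simp
    ultimately have near: "q \<in> ball x d1" "p \<in> ball x d1" "q \<in> ball x d2" "p \<in> ball x d2"
      "q \<in> M \<inter> ball x d3" using d q(1) by auto
    have "\<Psi> q \<in> T" "\<Psi> p \<in> T" using d2(2) near q(1) p by auto
    then have "\<Psi> q - \<Psi> p \<in> T" by (intro subspace_diff T)
    \<comment> \<open>The vector \<Psi> q - \<Psi> p of \<open>T\<close> competes with the
      projection of q - p and is itself close to q - p.\<close>
    then have "norm ((q - p) - proj T (q - p)) \<le> norm ((q - p) - (\<Psi> q - \<Psi> p))"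
      by (rule norm_proj_residual_le[OF T])
    also have "\<dots> \<le> e' * norm (q - p)"
      using d1(2)[OF near(1,2)] by (simp add: norm_minus_commute)
    also have "\<dots> \<le> e' * (2 * norm (y - p))" using qp e'(1) by (intro mult_left_mono) auto
    finally have 1: "norm ((q - p) - proj T (q - p)) \<le> 2 * e' * norm (y - p)" by simp
    have "norm (proj T (y - q)) \<le> 2 * e' * norm (y - q)" using d3(2)[OF near(5) q(2)] .
    also have "\<dots> \<le> 2 * e' * norm (y - p)" using yq e'(1) by (intro mult_left_mono) auto
    finally have 2: "norm (proj T (y - q)) \<le> 2 * e' * norm (y - p)" .
    have "q - p - proj T (y - p) = ((q - p) - proj T (q - p)) - proj T (y - q)"
      by (simp add: linear_diff[OF linP])
    also have "norm \<dots> \<le> 2 * e' * norm (y - p) + 2 * e' * norm (y - p)"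
      using 1 2 norm_triangle_ineq4 by (meson add_mono order_trans)
    also have "\<dots> = 4 * e' * norm (y - p)" by simp
    also have "\<dots> \<le> e * norm (y - p)" using e'(3) by (intro mult_right_mono) auto
    finally show ?thesis by (simp add: q_def)
  qed
  then show "\<exists>d>0. \<forall>y\<in>ball x d. \<forall>p\<in>M \<inter> ball x d.
      norm (proj M y - p - proj T (y - p)) \<le> e * norm (y - p)"
    using d(1) by blast
qed

section \<open>Generalized alternating projections\<close>

text \<open>At p = proj C y the expansion of \<open>proj C\<close> reads 0 = P (y - p) + o(y - p),
  so P (y - p) may be subtracted from L (y - p) at the cost of a small error.\<close>

lemma linearizes_along_residual:
  fixes C :: "'a::euclidean_space set"
  assumes "closed C" "x \<in> C" and f: "linearizes_along C x f L"
    and P: "linearizes_along C x (proj C) P" and "0 < e"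
  shows "\<exists>d>0. \<forall>y\<in>ball x d. norm (f y - proj C y - (L (y - proj C y) - P (y - proj C y)))
           \<le> e * norm (y - proj C y)"
proof -
  have "e / 2 > 0" using \<open>0 < e\<close> by simp
  obtain d1 where d1: "d1 > 0" "\<And>y p. \<lbrakk>dist x y < d1; p \<in> C; dist x p < d1\<rbrakk> \<Longrightarrow>
    norm (f y - p - L (y - p)) \<le> e / 2 * norm (y - p)"
    using linearizes_alongE[OF f \<open>e / 2 > 0\<close>] by blast
  obtain d2 where d2: "d2 > 0" "\<And>y p. \<lbrakk>dist x y < d2; p \<in> C; dist x p < d2\<rbrakk> \<Longrightarrow>
    norm (proj C y - p - P (y - p)) \<le> e / 2 * norm (y - p)"
    using linearizes_alongE[OF P \<open>e / 2 > 0\<close>] by blast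
  \<comment> \<open>The point \<open>x\<close> of \<open>C\<close> competes with
    \<open>proj C y\<close>, which is therefore less than 2 d away from \<open>x\<close>.\<close>
  define d where "d = min d1 d2 / 2"
  have d: "d > 0" "2 * d \<le> d1" "2 * d \<le> d2" using d1(1) d2(1) by (auto simp: d_def)
  have "norm (f y - proj C y - (L (y - proj C y) - P (y - proj C y))) \<le> e * norm (y - proj C y)"
    if y: "y \<in> ball x d" for y
  proof -
    define p where "p = proj C y"
    have p: "p \<in> C" "dist y p \<le> dist y x"
      using assms(1,2) closest_point_in_set[of C y] closest_point_le[of C x y]
      by (auto simp: p_def proj_eq_closest_point)
    then have "dist x p < 2 * d"
      using y dist_triangle[of x p y] by (simp add: dist_commute)
    then have near: "dist x p < d1" "dist x p < d2" "dist x y < d1" "dist x y < d2"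
      using y d by auto
    have "f y - p - (L (y - p) - P (y - p))
        = (f y - p - L (y - p)) - (proj C y - p - P (y - p))"
      by (simp add: p_def)
    also have "norm \<dots> \<le> norm (f y - p - L (y - p)) + norm (proj C y - p - P (y - p))"
      by (rule norm_triangle_ineq4)
    also have "\<dots> \<le> e / 2 * norm (y - p) + e / 2 * norm (y - p)"
      using p(1) near by (intro add_mono d1(2) d2(2))
    finally show ?thesis by (simp add: p_def)
  qed
  then show ?thesis using d(1) by blast
qed

lemma linearizes_along_rproj:
  assumes "linearizes_along C x (proj M) (proj T)"
  shows "linearizes_along C x (rproj a M) (rproj a T)"
  using linearizes_along_convex_comb[OF linearizes_along_id assms, of a]
  by (simp add: rproj_def[abs_def])

lemma linearizes_along_GAP:
  assumes "linearizes_along C x (proj M) (proj S)" "linearizes_along C x (proj N) (proj T)"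
  shows "linearizes_along C x (GAP \<alpha> \<alpha>1 \<alpha>2 M N) (GAP \<alpha> \<alpha>1 \<alpha>2 S T)"
  using linearizes_along_convex_comb[OF linearizes_along_id
      linearizes_along_compose[OF linearizes_along_rproj[OF assms(2), of \<alpha>1]
        linearizes_along_rproj[OF assms(1), of \<alpha>2]], of \<alpha>]
  by (simp add: GAP_def[abs_def])

section \<open>Relaxed projections onto subspaces and fixed points of their composition\<close>

lemma rproj_eq_self_iff:
  assumes "subspace T" "a \<noteq> 0"
  shows "rproj a T x = x \<longleftrightarrow> x \<in> T"
proof -
  have "rproj a T x = x \<longleftrightarrow> a *\<^sub>R (proj T x - x) = 0"
    by (simp add: rproj_def algebra_simps)
  then show ?thesis
    using assms proj_subspace_in[OF assms(1), of x] proj_subspace_self[OF assms(1), of x] by auto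
qed

text \<open>Relaxation multiplies the normal component by 1 - a, and 1 - (1 - a)^2 = a (2 -
  a).\<close>

lemma norm_rproj:
  assumes "subspace T"
  shows "norm (rproj a T x) ^ 2 = norm x ^ 2 - a * (2 - a) * norm (x - proj T x) ^ 2"
proof -
  have "(proj T x) \<bullet> (x - proj T x) = 0"
    using proj_subspace_orth[OF assms proj_subspace_in[OF assms]] by (simp add: inner_commute)
  then have "norm (proj T x + (1 - a) *\<^sub>R (x - proj T x)) ^ 2
      = norm (proj T x) ^ 2 + norm ((1 - a) *\<^sub>R (x - proj T x)) ^ 2"
    by (intro norm_add_Pythagorean) (simp add: orthogonal_def)
  moreover have "rproj a T x = proj T x + (1 - a) *\<^sub>R (x - proj T x)"
    by (simp add: rproj_def algebra_simps)
  ultimately show ?thesis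
    using norm_proj_subspace[OF assms, of x]
    by (simp add: power_mult_distrib) (simp add: algebra_simps power2_eq_square)
qed

lemma norm_rproj_le:
  assumes "subspace T" "0 \<le> a" "a \<le> 2"
  shows "norm (rproj a T x) \<le> norm x"
proof (rule power2_le_imp_le)
  show "norm (rproj a T x) ^ 2 \<le> norm x ^ 2"
    using norm_rproj[OF assms(1), of a x] assms(2,3) by simp
qed simp

lemma norm_rproj_eq_imp_in:
  assumes "subspace T" "0 < a" "a < 2" "norm (rproj a T x) = norm x"
  shows "x \<in> T"
proof -
  have "x - proj T x = 0" using norm_rproj[OF assms(1), of a x] assms(2-4) by simp
  then show ?thesis using proj_subspace_in[OF assms(1), of x] by simp
qed

text \<open>A fixed vector loses no norm under either nonexpansive relaxation, so the one with
  parameter below 2 forces its argument into its subspace. Two reflections would not do: for S = T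
  their composition is the identity.\<close>

lemma GAP_fixed_iff:
  assumes S: "subspace S" and T: "subspace T" and "\<alpha> \<noteq> 0"
    and a: "0 < \<alpha>1" "\<alpha>1 \<le> 2" "0 < \<alpha>2" "\<alpha>2 \<le> 2" "\<alpha>1 \<noteq> 2 \<or> \<alpha>2 \<noteq> 2"
  shows "GAP \<alpha> \<alpha>1 \<alpha>2 S T x = x \<longleftrightarrow> x \<in> S \<inter> T"
proof
  assume "x \<in> S \<inter> T"
  then have "rproj \<alpha>1 T x = x" "rproj \<alpha>2 S x = x"
    using rproj_eq_self_iff[OF S] rproj_eq_self_iff[OF T] a by auto
  then show "GAP \<alpha> \<alpha>1 \<alpha>2 S T x = x" by (simp add: GAP_def algebra_simps)
next
  assume "GAP \<alpha> \<alpha>1 \<alpha>2 S T x = x"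
  then have "\<alpha> *\<^sub>R (rproj \<alpha>2 S (rproj \<alpha>1 T x) - x) = 0"
    by (simp add: GAP_def algebra_simps)
  then have eq: "rproj \<alpha>2 S (rproj \<alpha>1 T x) = x" using \<open>\<alpha> \<noteq> 0\<close> by simp
  have norms: "norm (rproj \<alpha>1 T x) = norm x"
    using norm_rproj_le[OF S, of \<alpha>2 "rproj \<alpha>1 T x"] norm_rproj_le[OF T, of \<alpha>1 x] eq a by simp
  show "x \<in> S \<inter> T"
  proof (cases "\<alpha>1 = 2")
    case False
    then have "x \<in> T" using norm_rproj_eq_imp_in[OF T _ _ norms] a by simp
    then have "rproj \<alpha>1 T x = x" using rproj_eq_self_iff[OF T] a by simp
    then have "x \<in> S" using eq rproj_eq_self_iff[OF S] a by simp
    with \<open>x \<in> T\<close> show ?thesis by simp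
  next
    case True
    \<comment> \<open>Now \<alpha>2 < 2, so the reflected vector lies in \<open>S\<close>; the
      second relaxation fixes it, and hence it equals \<open>x\<close>.\<close>
    then have "rproj \<alpha>1 T x \<in> S"
      using norm_rproj_eq_imp_in[OF S, of \<alpha>2 "rproj \<alpha>1 T x"] norms eq a by simp
    then have "rproj \<alpha>2 S (rproj \<alpha>1 T x) = rproj \<alpha>1 T x" using rproj_eq_self_iff[OF S] a by simp
    then have "rproj \<alpha>1 T x = x" using eq by simp
    with \<open>rproj \<alpha>1 T x \<in> S\<close> show ?thesis
      using rproj_eq_self_iff[OF T] a by (metis IntI less_irrefl)
  qed
qed

text \<open>The relaxation moves \<open>x\<close> along its component normal to \<open>T\<close>,
  which is orthogonal to \<open>W\<close>.\<close>

lemma proj_rproj_subspace: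
  assumes "subspace W" "subspace T" "W \<subseteq> T"
  shows "proj W (rproj a T x) = proj W x"
proof (rule proj_subspace_eqI[OF assms(1) proj_subspace_in[OF assms(1)]])
  fix v assume v: "v \<in> W"
  have "rproj a T x - proj W x = (x - proj W x) - a *\<^sub>R (x - proj T x)"
    by (simp add: rproj_def algebra_simps)
  then show "(rproj a T x - proj W x) \<bullet> v = 0"
    using proj_subspace_orth[OF assms(1) v, of x] proj_subspace_orth[OF assms(2), of v x] v assms(3)
    by (auto simp: inner_diff_left)
qed

section \<open>Powers and spectrum off the fixed space\<close>

lemma proj_GAP:
  assumes "subspace S" "subspace T"
  shows "proj (S \<inter> T) (GAP \<alpha> \<alpha>1 \<alpha>2 S T x) = proj (S \<inter> T) x"
proof -
  have W: "subspace (S \<inter> T)" using assms by (rule subspace_inter)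
  have "proj (S \<inter> T) (rproj \<alpha>2 S (rproj \<alpha>1 T x)) = proj (S \<inter> T) x"
    using proj_rproj_subspace[OF W] assms by simp
  then show ?thesis
    unfolding GAP_def linear_add[OF linear_proj[OF W]] linear_scale[OF linear_proj[OF W]]
    by (simp add: algebra_simps)
qed

text \<open>Cross terms collapse because SP = PS = P. Exponent zero is excluded: there the two sides
  would be x and x - P x.\<close>

lemma funpow_diff_projection:
  fixes S P :: "'a::real_vector \<Rightarrow> 'a"
  assumes "linear S" "linear P" "\<And>x. S (P x) = P x" "\<And>x. P (S x) = P x" "\<And>x. P (P x) = P x"
  shows "((\<lambda>x. S x - P x) ^^ Suc n) x = (S ^^ Suc n) x - P x"
proof (induction n)
  case 0
  show ?case by simp
next
  case (Suc n)
  have P: "P ((S ^^ m) x) = P x" for m by (induction m) (simp_all add: assms(4))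
  have "((\<lambda>x. S x - P x) ^^ Suc (Suc n)) x = S ((S ^^ Suc n) x - P x) - P ((S ^^ Suc n) x - P x)"
    unfolding Suc[symmetric] by simp
  also have "\<dots> = (S ^^ Suc (Suc n)) x - P x"
    unfolding linear_diff[OF assms(1)] linear_diff[OF assms(2)] P assms(3,5) by simp
  finally show ?case .
qed

text \<open>Applying \<open>P\<close> to the eigenvector equation gives l P w = 0, so either l = 0,
  or P w = 0 and \<open>w\<close> is an eigenvector of \<open>S\<close>. In the latter case l = 1
  would make \<open>w\<close> fixed, hence w = P w = 0.\<close>

lemma eigenvalues_diff_projection:
  fixes S P :: "'a::euclidean_space \<Rightarrow> 'a"
  assumes lin: "linear S" "linear P" and PS: "\<And>x. P (S x) = P x" and PP: "\<And>x. P (P x) = P x"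
    and fixed: "\<And>x. S x = x \<Longrightarrow> P x = x"
  shows "eigenvalues (\<lambda>x. S x - P x) \<subseteq> {0} \<union> (eigenvalues S - {1})"
proof
  fix l assume "l \<in> eigenvalues (\<lambda>x. S x - P x)"
  then obtain w where w: "w \<noteq> 0" "map_prod (\<lambda>x. S x - P x) (\<lambda>x. S x - P x) w = cscale l w"
    unfolding eigenvalues_iff by blast
  have diff: "map_prod S S w - map_prod P P w = cscale l w"
    unfolding w(2)[symmetric] by (cases w) simp
  have "cscale l (map_prod P P w) = map_prod P P (map_prod S S w - map_prod P P w)"
    unfolding diff by (simp add: cscale_map_prod[OF lin(2)])
  also have "\<dots> = 0"
    by (cases w) (simp add: linear_diff[OF lin(2)] PS PP zero_prod_def)
  finally have "l = 0 \<or> map_prod P P w = 0" by (simp add: cscale_eq_0_iff)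
  moreover have "l \<in> eigenvalues S - {1}" if P0: "map_prod P P w = 0"
  proof -
    have S: "map_prod S S w = cscale l w" using diff P0 by simp
    have "l \<noteq> 1"
    proof
      assume "l = 1"
      then have "map_prod S S w = w" using S by (simp add: cscale_1)
      then have "map_prod P P w = w" using fixed by (cases w) auto
      then show False using P0 w(1) by simp
    qed
    then show ?thesis using S w(1) unfolding Diff_iff eigenvalues_iff by blast
  qed
  ultimately show "l \<in> {0} \<union> (eigenvalues S - {1})" by blast
qed

lemma gamma_ge:
  assumes "linear A" "l \<in> {0} \<union> (eigenvalues A - {1})"
  shows "cmod l \<le> gamma A"
  unfolding gamma_def
proof (rule Max_ge)
  show "finite (cmod ` ({0} \<union> (eigenvalues A - {1})))"
    using finite_eigenvalues[OF assms(1)] by simp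
  show "cmod l \<in> cmod ` ({0} \<union> (eigenvalues A - {1}))" using assms(2) by (rule imageI)
qed

text \<open>The factor one half leaves room for the linearization error.\<close>

lemma powers_eventually_le_half:
  fixes A :: "'a::euclidean_space \<Rightarrow> 'a"
  assumes "linear A" "\<And>l. l \<in> eigenvalues A \<Longrightarrow> cmod l \<le> g" "0 \<le> g" "g < \<mu>"
  shows "\<forall>\<^sub>F n in sequentially. \<forall>x. norm ((A ^^ n) x) \<le> \<mu> ^ n / 2 * norm x"
proof -
  \<comment> \<open>A rate strictly between \<open>g\<close> and \<mu> lets (r / \<mu>)^n absorb the
    constant of \<open>power_bound\<close>.\<close>
  define r where "r = (g + \<mu>) / 2"
  have r: "g < r" "r < \<mu>" "0 < r" using assms(3,4) by (auto simp: r_def)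
  have "cmod l < r" if "l \<in> eigenvalues A" for l using assms(2)[OF that] r(1) by simp
  then obtain C where C: "\<And>n x. norm ((A ^^ n) x) \<le> C * r ^ n * norm x"
    using power_bound[OF assms(1)] by blast
  have "(\<lambda>n. C * (r / \<mu>) ^ n) \<longlonglongrightarrow> C * 0"
    using r by (intro tendsto_intros LIMSEQ_power_zero) simp
  then have "\<forall>\<^sub>F n in sequentially. C * (r / \<mu>) ^ n < 1 / 2"
    by (rule order_tendstoD) simp
  then show ?thesis
  proof eventually_elim
    case (elim n)
    then have "C * r ^ n \<le> \<mu> ^ n / 2"
      using r by (simp add: power_divide field_simps)
    then show ?case using C by (meson mult_right_mono norm_ge_zero order_trans)
  qed
qed

theorem theorem4:
  fixes M N :: "'a::euclidean_space set" and xbar :: 'a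
    and k :: nat and \<alpha> \<alpha>1 \<alpha>2 :: real
  assumes "k \<ge> 2"
    and "closed M" and "closed N"
    and "Ck_manifold_around k M xbar" and "Ck_manifold_around k N xbar"
    and "Ck_manifold_around k (M \<inter> N) xbar"
    and "tangent_space (M \<inter> N) xbar = tangent_space M xbar \<inter> tangent_space N xbar"
    and "0 < \<alpha>" and "\<alpha> \<le> 1"
    and "0 < \<alpha>1" and "\<alpha>1 \<le> 2" and "0 < \<alpha>2" and "\<alpha>2 \<le> 2"
    and "(\<alpha>1 < 2 \<and> \<alpha>2 < 2) \<or> (\<alpha> < 1 \<and> (\<alpha>1 \<noteq> 2 \<or> \<alpha>2 \<noteq> 2))"
  shows
    "(\<forall>c. c > onorm (\<lambda>x. GAP \<alpha> \<alpha>1 \<alpha>2 (tangent_space M xbar) (tangent_space N xbar) x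
                         - proj (tangent_space M xbar \<inter> tangent_space N xbar) x) \<longrightarrow>
        (\<exists>\<eta>>0. \<forall>x\<in>cball xbar \<eta>.
            norm (GAP \<alpha> \<alpha>1 \<alpha>2 M N x - proj (M \<inter> N) x) \<le> c * norm (x - proj (M \<inter> N) x)))
     \<and>
     (\<forall>\<mu>. gamma (GAP \<alpha> \<alpha>1 \<alpha>2 (tangent_space M xbar) (tangent_space N xbar)) < \<mu> \<and> \<mu> < 1 \<longrightarrow>
        (\<exists>K::nat. \<forall>j\<ge>K.
           Limsup (at xbar within - (M \<inter> N))
             (\<lambda>x. ereal (norm (((GAP \<alpha> \<alpha>1 \<alpha>2 M N) ^^ j) x - proj (M \<inter> N) x)
                         / norm (x - proj (M \<inter> N) x)))
           \<le> ereal (\<mu> ^ j)))"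
proof -
  let ?C = "M \<inter> N"
  define TM TN where "TM = tangent_space M xbar" and "TN = tangent_space N xbar"
  define G where "G = GAP \<alpha> \<alpha>1 \<alpha>2 M N"
  define S where "S = GAP \<alpha> \<alpha>1 \<alpha>2 TM TN"
  define P where "P = proj (TM \<inter> TN)"
  have x: "xbar \<in> ?C" using assms(6) by (simp add: Ck_manifold_around_def)
  have C: "closed ?C" using assms(2,3) by (rule closed_Int)
  have "1 \<le> k" using assms(1) by simp
  obtain \<Psi>M where \<Psi>M: "straightens \<Psi>M M xbar TM"
    using tangent_space_straightens[OF assms(4) \<open>1 \<le> k\<close>] unfolding TM_def by blast
  obtain \<Psi>N where \<Psi>N: "straightens \<Psi>N N xbar TN"
    using tangent_space_straightens[OF assms(5) \<open>1 \<le> k\<close>] unfolding TN_def by blast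
  \<comment> \<open>The tangent space hypothesis enters here: it identifies the linearization of
    \<open>proj ?C\<close> as the projection onto \<open>TM \<inter> TN\<close>.\<close>
  obtain \<Psi>C where \<Psi>C: "straightens \<Psi>C ?C xbar (TM \<inter> TN)"
    using tangent_space_straightens[OF assms(6) \<open>1 \<le> k\<close>]
    unfolding TM_def TN_def assms(7) by blast
  note \<Psi> = \<Psi>M \<Psi>N \<Psi>C
  then have sub: "subspace TM" "subspace TN" "subspace (TM \<inter> TN)"
    by (simp_all add: straightens_def)
  have projs: "linearizes_along ?C xbar (proj M) (proj TM)" "linearizes_along ?C xbar (proj N) (proj TN)"
    using linearizes_along_proj[OF \<Psi>(1) assms(2)] linearizes_along_proj[OF \<Psi>(2) assms(3)] x
    by (auto intro: linearizes_along_subset)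
  have linP: "linearizes_along ?C xbar (proj ?C) P"
    using linearizes_along_proj[OF \<Psi>(3) C] x by (auto simp: P_def)
  have linG: "linearizes_along ?C xbar G S"
    unfolding G_def S_def by (rule linearizes_along_GAP[OF projs])
  have S: "linear S" and P: "linear P"
    using linG linP by (auto dest: linearizes_along_linear)
  have fixed: "S y = y \<longleftrightarrow> y \<in> TM \<inter> TN" for y
    unfolding S_def
  proof (rule GAP_fixed_iff[OF sub(1,2)])
    show "\<alpha> \<noteq> 0" using assms(8) by simp
    \<comment> \<open>Either alternative on the parameters excludes two reflections.\<close>
    show "\<alpha>1 \<noteq> 2 \<or> \<alpha>2 \<noteq> 2" using assms(14) by auto
  qed (rule assms(10-13))+
  have P_self: "P y = y" if "y \<in> TM \<inter> TN" for y
    unfolding P_def by (rule proj_subspace_self[OF sub(3) that])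
  have P_in: "P y \<in> TM \<inter> TN" for y
    unfolding P_def by (rule proj_subspace_in[OF sub(3)])
  have SP: "S (P y) = P y" and PP: "P (P y) = P y" for y
    using fixed P_self P_in by auto
  have PS: "P (S y) = P y" for y unfolding P_def S_def by (rule proj_GAP[OF sub(1,2)])
  define D where "D y = S y - P y" for y
  have D: "linear D" unfolding D_def by (rule linear_compose_sub[OF S P])
  show ?thesis
  proof (intro conjI allI impI; (elim conjE)?)
    fix c
    assume "onorm (\<lambda>x. GAP \<alpha> \<alpha>1 \<alpha>2 (tangent_space M xbar) (tangent_space N xbar) x
                         - proj (tangent_space M xbar \<inter> tangent_space N xbar) x) < c"
    then have "onorm D < c" by (simp add: D_def[abs_def] S_def P_def TM_def TN_def)
    \<comment> \<open>The slack \<open>c - onorm D\<close> is spent as the tolerance of the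
      linearization.\<close>
    then obtain d where d: "d > 0"
      "\<forall>y\<in>ball xbar d. norm (G y - proj ?C y - D (y - proj ?C y)) \<le> (c - onorm D) * norm (y - proj ?C y)"
      using linearizes_along_residual[OF C x linG linP, of "c - onorm D"] unfolding D_def by auto
    have "norm (G y - proj ?C y) \<le> c * norm (y - proj ?C y)" if "y \<in> cball xbar (d / 2)" for y
    proof -
      have "norm (G y - proj ?C y - D (y - proj ?C y)) \<le> (c - onorm D) * norm (y - proj ?C y)"
        using d that by auto
      moreover have "norm (D (y - proj ?C y)) \<le> onorm D * norm (y - proj ?C y)"
        using D by (intro onorm) (simp add: linear_conv_bounded_linear)
      ultimately have "norm (G y - proj ?C y) \<le> (c - onorm D) * norm (y - proj ?C y) + onorm D * norm (y - proj ?C y)"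
        using norm_triangle_ineq[of "G y - proj ?C y - D (y - proj ?C y)" "D (y - proj ?C y)"] by simp
      then show ?thesis by (simp add: algebra_simps)
    qed
    then show "\<exists>\<eta>>0. \<forall>x\<in>cball xbar \<eta>.
        norm (GAP \<alpha> \<alpha>1 \<alpha>2 M N x - proj ?C x) \<le> c * norm (x - proj ?C x)"
      using d(1) unfolding G_def by (intro exI[of _ "d / 2"]) auto
  next
    fix \<mu>
    assume "gamma (GAP \<alpha> \<alpha>1 \<alpha>2 (tangent_space M xbar) (tangent_space N xbar)) < \<mu>"
    then have \<mu>: "gamma S < \<mu>" by (simp add: S_def TM_def TN_def)
    have g: "0 \<le> gamma S" using gamma_ge[OF S, of 0] by simp
    have ev: "eigenvalues D \<subseteq> {0} \<union> (eigenvalues S - {1})"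
      unfolding D_def[abs_def]
      by (rule eigenvalues_diff_projection[OF S P PS PP]) (simp add: fixed P_self)
    then have "\<forall>\<^sub>F n in sequentially. \<forall>y. norm ((D ^^ n) y) \<le> \<mu> ^ n / 2 * norm y"
      using gamma_ge[OF S] g \<mu> by (intro powers_eventually_le_half[OF D]) auto
    then obtain K where K: "\<And>n y. n \<ge> K \<Longrightarrow> norm ((D ^^ n) y) \<le> \<mu> ^ n / 2 * norm y"
      unfolding eventually_sequentially by blast
    \<comment> \<open>\<open>Suc K\<close> excludes exponent zero, where \<open>D ^^ j\<close> is
      not the difference of \<open>S ^^ j\<close> and \<open>P\<close>.\<close>
    have "Limsup (at xbar within - ?C) (\<lambda>y. ereal (norm ((G ^^ j) y - proj ?C y) / norm (y - proj ?C y)))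
        \<le> ereal (\<mu> ^ j)" if j: "j \<ge> Suc K" for j
    proof -
      obtain i where i: "j = Suc i" using j by (cases j) auto
      have Dj: "(S ^^ j) y - P y = (D ^^ j) y" for y
        unfolding i D_def[abs_def] by (rule funpow_diff_projection[symmetric]) (fact S P SP PS PP)+
      have "\<mu> > 0" using g \<mu> by simp
      \<comment> \<open>Half of \<mu> ^ j covers the linearization error, the other half
        \<open>D ^^ j\<close>. The exponent is fixed, so the radius may depend on it.\<close>
      then have "\<mu> ^ j / 2 > 0" by simp
      from linearizes_along_residual[OF C x linearizes_along_funpow[OF linG, of j] linP this]
      obtain d where d: "d > 0"
        "\<forall>y\<in>ball xbar d. norm ((G ^^ j) y - proj ?C y - (D ^^ j) (y - proj ?C y)) \<le> \<mu> ^ j / 2 * norm (y - proj ?C y)"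
        unfolding Dj by blast
      have "norm ((G ^^ j) y - proj ?C y) / norm (y - proj ?C y) \<le> \<mu> ^ j"
        if "y \<in> ball xbar d" "y \<notin> ?C" for y
      proof -
        have "proj ?C y \<in> ?C"
          unfolding proj_eq_closest_point using C x by (intro closest_point_in_set) auto
        then have pos: "norm (y - proj ?C y) > 0" using that(2) by auto
        have "norm ((G ^^ j) y - proj ?C y) \<le> \<mu> ^ j / 2 * norm (y - proj ?C y) + \<mu> ^ j / 2 * norm (y - proj ?C y)"
          using d(2) that(1) K[of j "y - proj ?C y"] j
            norm_triangle_ineq[of "(G ^^ j) y - proj ?C y - (D ^^ j) (y - proj ?C y)" "(D ^^ j) (y - proj ?C y)"]
          by fastforce
        then show ?thesis using pos by (simp add: pos_divide_le_eq)
      qed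
      then have "\<forall>\<^sub>F y in at xbar within - ?C. norm ((G ^^ j) y - proj ?C y) / norm (y - proj ?C y) \<le> \<mu> ^ j"
        unfolding eventually_at using d(1) by (intro exI[of _ d]) (auto simp: dist_commute)
      then show ?thesis by (intro Limsup_bounded) simp
    qed
    then show "\<exists>K. \<forall>j\<ge>K. Limsup (at xbar within - ?C)
        (\<lambda>y. ereal (norm ((GAP \<alpha> \<alpha>1 \<alpha>2 M N ^^ j) y - proj ?C y) / norm (y - proj ?C y))) \<le> ereal (\<mu> ^ j)"
      unfolding G_def by blast
  qed
qed

end
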